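(* Let $\mathcal{A}$ be an $\omega$-categorical and $\omega$-stable structure, let $\mathcal{K}$ be a field (without atoms), and let $X$ be a definable set in $\mathbf{ZFA}(\mathcal{A})$. Then, inside $\mathbf{ZFA}(\mathcal{A})$, the free $\mathcal{K}$-vector space $F(\overline{X})$ on the set $\overline{X}$ of ultrafilters on $X$ is isomorphic to the vector space $\mathcal{K}^X$ of (finitely supported) functions $X\to\mathcal{K}$.
   Context: Let $\mathcal{A}$ be a countable first-order structure with universe $A$ (the atoms). $\mathrm{Aut}(\mathcal{A})$ acts on sets with atoms by acting on atoms. A set is supported by a finite $A_0\subseteq A$ if it is fixed by every automorphism fixing $A_0$ pointwise. $\mathbf{ZFA}(\mathcal{A})$ is the permutation (Fraenkel–Mostowski) model consisting of hereditarily finitely supported sets; all constructions (power sets, function spaces $\mathcal{K}^X$, ultrafilters, vector spaces, bases, isomorphisms) are taken inside this model, i.e. only finitely supported objects are used. A set $X$ is $A_0$-equivariant if it is supported by $A_0$, and $A_0$-definable if moreover it has finitely many orbits under the group of automorphisms fixing $A_0$ pointwise; definable means $A_0$-definable for some finite $A_0$. For a set $X$, $\overline{X}$ (the Stone–Čech compactification of $X$) denotes the set of finitely supported ultrafilters on the Boolean algebra $\mathcal{P}(X)$ of finitely supported subsets of $X$. $F(S)$ denotes the free $\mathcal{K}$-vector space on $S$ (finitely supported formal finite linear combinations). A theory is $\omega$-categorical if each $S_n(\emptyset)$ is finite, and $\omega$-stable if $S_n(A)$ is countable for every $n$. *)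

theory Defs
  imports Main "HOL-Library.Countable_Set"
begin

text \<open>A first-order structure with universe the whole type 'a (the atoms),
function symbols 'f and relation symbols 'r (constants = 0-ary functions).\<close>

record ('a, 'f, 'r) fo_structure =
  fn_ar  :: "'f \<Rightarrow> nat"
  fn_int :: "'f \<Rightarrow> 'a list \<Rightarrow> 'a"
  rel_ar :: "'r \<Rightarrow> nat"
  rel_int :: "'r \<Rightarrow> 'a list set"

datatype ('f, 'a) trm = Var nat | Par 'a | Fn 'f "('f, 'a) trm list"

datatype ('f, 'r, 'a) fm =
    Eq "('f, 'a) trm" "('f, 'a) trm"
  | Rel 'r "('f, 'a) trm list"
  | Neg "('f, 'r, 'a) fm"
  | Conj "('f, 'r, 'a) fm" "('f, 'r, 'a) fm"
  | Ex nat "('f, 'r, 'a) fm"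

primrec eval_trm :: "('a, 'f, 'r, 'z) fo_structure_scheme \<Rightarrow> (nat \<Rightarrow> 'a) \<Rightarrow> ('f, 'a) trm \<Rightarrow> 'a" where
  "eval_trm S v (Var n) = v n"
| "eval_trm S v (Par a) = a"
| "eval_trm S v (Fn f ts) = fn_int S f (map (eval_trm S v) ts)"

fun wf_trm :: "('a, 'f, 'r, 'z) fo_structure_scheme \<Rightarrow> ('f, 'a) trm \<Rightarrow> bool" where
  "wf_trm S (Var n) = True"
| "wf_trm S (Par a) = True"
| "wf_trm S (Fn f ts) = (length ts = fn_ar S f \<and> (\<forall>t\<in>set ts. wf_trm S t))"

primrec fv_trm :: "('f, 'a) trm \<Rightarrow> nat set" where
  "fv_trm (Var n) = {n}"
| "fv_trm (Par a) = {}"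
| "fv_trm (Fn f ts) = \<Union> (set (map fv_trm ts))"

primrec par_trm :: "('f, 'a) trm \<Rightarrow> 'a set" where
  "par_trm (Var n) = {}"
| "par_trm (Par a) = {a}"
| "par_trm (Fn f ts) = \<Union> (set (map par_trm ts))"

primrec sat :: "('a, 'f, 'r, 'z) fo_structure_scheme \<Rightarrow> (nat \<Rightarrow> 'a) \<Rightarrow> ('f, 'r, 'a) fm \<Rightarrow> bool" where
  "sat S v (Eq t u) = (eval_trm S v t = eval_trm S v u)"
| "sat S v (Rel R ts) = (map (eval_trm S v) ts \<in> rel_int S R)"
| "sat S v (Neg \<phi>) = (\<not> sat S v \<phi>)"
| "sat S v (Conj \<phi> \<psi>) = (sat S v \<phi> \<and> sat S v \<psi>)"
| "sat S v (Ex x \<phi>) = (\<exists>a. sat S (v(x := a)) \<phi>)"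

primrec wf_fm :: "('a, 'f, 'r, 'z) fo_structure_scheme \<Rightarrow> ('f, 'r, 'a) fm \<Rightarrow> bool" where
  "wf_fm S (Eq t u) = (wf_trm S t \<and> wf_trm S u)"
| "wf_fm S (Rel R ts) = (length ts = rel_ar S R \<and> (\<forall>t\<in>set ts. wf_trm S t))"
| "wf_fm S (Neg \<phi>) = wf_fm S \<phi>"
| "wf_fm S (Conj \<phi> \<psi>) = (wf_fm S \<phi> \<and> wf_fm S \<psi>)"
| "wf_fm S (Ex x \<phi>) = wf_fm S \<phi>"

primrec fv_fm :: "('f, 'r, 'a) fm \<Rightarrow> nat set" where
  "fv_fm (Eq t u) = fv_trm t \<union> fv_trm u"
| "fv_fm (Rel R ts) = \<Union> (set (map fv_trm ts))"
| "fv_fm (Neg \<phi>) = fv_fm \<phi>"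
| "fv_fm (Conj \<phi> \<psi>) = fv_fm \<phi> \<union> fv_fm \<psi>"
| "fv_fm (Ex x \<phi>) = fv_fm \<phi> - {x}"

primrec par_fm :: "('f, 'r, 'a) fm \<Rightarrow> 'a set" where
  "par_fm (Eq t u) = par_trm t \<union> par_trm u"
| "par_fm (Rel R ts) = \<Union> (set (map par_trm ts))"
| "par_fm (Neg \<phi>) = par_fm \<phi>"
| "par_fm (Conj \<phi> \<psi>) = par_fm \<phi> \<union> par_fm \<psi>"
| "par_fm (Ex x \<phi>) = par_fm \<phi>"

definition fm_over :: "('a, 'f, 'r, 'z) fo_structure_scheme \<Rightarrow> nat \<Rightarrow> 'a set \<Rightarrow> ('f, 'r, 'a) fm \<Rightarrow> bool" where
  "fm_over S n B \<phi> \<longleftrightarrow> wf_fm S \<phi> \<and> fv_fm \<phi> \<subseteq> {..<n} \<and> par_fm \<phi> \<subseteq> B"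

text \<open>Complete n-types over B \<subseteq> A: complete sets of L(B)-formulas in n variables that
  are consistent with the theory of (A, b)_(b in B), i.e. finitely satisfiable in A.\<close>
definition complete_type :: "('a, 'f, 'r, 'z) fo_structure_scheme \<Rightarrow> nat \<Rightarrow> 'a set \<Rightarrow> ('f, 'r, 'a) fm set \<Rightarrow> bool" where
  "complete_type S n B p \<longleftrightarrow>
     (\<forall>\<phi>\<in>p. fm_over S n B \<phi>) \<and>
     (\<forall>F. finite F \<and> F \<subseteq> p \<longrightarrow> (\<exists>v. \<forall>\<phi>\<in>F. sat S v \<phi>)) \<and>
     (\<forall>\<phi>. fm_over S n B \<phi> \<longrightarrow> \<phi> \<in> p \<or> Neg \<phi> \<in> p)"

definition types :: "('a, 'f, 'r, 'z) fo_structure_scheme \<Rightarrow> nat \<Rightarrow> 'a set \<Rightarrow> ('f, 'r, 'a) fm set set" where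
  "types S n B = {p. complete_type S n B p}"

definition omega_categorical :: "('a, 'f, 'r, 'z) fo_structure_scheme \<Rightarrow> bool" where
  "omega_categorical S \<longleftrightarrow> (\<forall>n. finite (types S n {}))"

definition omega_stable :: "('a, 'f, 'r, 'z) fo_structure_scheme \<Rightarrow> bool" where
  "omega_stable S \<longleftrightarrow> (\<forall>n. countable (types S n UNIV))"

definition aut :: "('a, 'f, 'r, 'z) fo_structure_scheme \<Rightarrow> ('a \<Rightarrow> 'a) \<Rightarrow> bool" where
  "aut S \<pi> \<longleftrightarrow> bij \<pi> \<and>
     (\<forall>f xs. length xs = fn_ar S f \<longrightarrow> \<pi> (fn_int S f xs) = fn_int S f (map \<pi> xs)) \<and>
     (\<forall>R xs. length xs = rel_ar S R \<longrightarrow> (map \<pi> xs \<in> rel_int S R \<longleftrightarrow> xs \<in> rel_int S R))"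

definition fix_grp :: "('a, 'f, 'r, 'z) fo_structure_scheme \<Rightarrow> 'a set \<Rightarrow> ('a \<Rightarrow> 'a) set" where
  "fix_grp S B = {\<pi>. aut S \<pi> \<and> (\<forall>a\<in>B. \<pi> a = a)}"

section \<open>Sets in ZFA(A), modelled as nominal sets over Aut(A)\<close>

text \<open>The elements of the model relevant to the statement live in a type 'x on which
  Aut(A) acts via act; every element is finitely supported.\<close>

definition zfa_universe :: "('a, 'f, 'r, 'z) fo_structure_scheme \<Rightarrow> (('a \<Rightarrow> 'a) \<Rightarrow> 'x \<Rightarrow> 'x) \<Rightarrow> bool" where
  "zfa_universe S act \<longleftrightarrow>
     (\<forall>x. act id x = x) \<and>
     (\<forall>\<pi> \<sigma> x. aut S \<pi> \<and> aut S \<sigma> \<longrightarrow> act (\<pi> \<circ> \<sigma>) x = act \<pi> (act \<sigma> x)) \<and>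
     (\<forall>x. \<exists>B. finite B \<and> (\<forall>\<pi>\<in>fix_grp S B. act \<pi> x = x))"

definition act_set :: "(('a \<Rightarrow> 'a) \<Rightarrow> 'x \<Rightarrow> 'x) \<Rightarrow> ('a \<Rightarrow> 'a) \<Rightarrow> 'x set \<Rightarrow> 'x set" where
  "act_set act \<pi> U = act \<pi> ` U"

definition act_uf :: "(('a \<Rightarrow> 'a) \<Rightarrow> 'x \<Rightarrow> 'x) \<Rightarrow> ('a \<Rightarrow> 'a) \<Rightarrow> 'x set set \<Rightarrow> 'x set set" where
  "act_uf act \<pi> \<U> = act_set act \<pi> ` \<U>"

definition supports_set :: "('a, 'f, 'r, 'z) fo_structure_scheme \<Rightarrow> (('a \<Rightarrow> 'a) \<Rightarrow> 'x \<Rightarrow> 'x) \<Rightarrow> 'a set \<Rightarrow> 'x set \<Rightarrow> bool" where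
  "supports_set S act B X \<longleftrightarrow> (\<forall>\<pi>\<in>fix_grp S B. act_set act \<pi> X = X)"

definition orbit :: "('a, 'f, 'r, 'z) fo_structure_scheme \<Rightarrow> (('a \<Rightarrow> 'a) \<Rightarrow> 'x \<Rightarrow> 'x) \<Rightarrow> 'a set \<Rightarrow> 'x \<Rightarrow> 'x set" where
  "orbit S act B x = {act \<pi> x | \<pi>. \<pi> \<in> fix_grp S B}"

definition definable_set :: "('a, 'f, 'r, 'z) fo_structure_scheme \<Rightarrow> (('a \<Rightarrow> 'a) \<Rightarrow> 'x \<Rightarrow> 'x) \<Rightarrow> 'x set \<Rightarrow> bool" where
  "definable_set S act X \<longleftrightarrow>
     (\<exists>A0. finite A0 \<and> supports_set S act A0 X \<and> finite (orbit S act A0 ` X))"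

definition fs_pow :: "('a, 'f, 'r, 'z) fo_structure_scheme \<Rightarrow> (('a \<Rightarrow> 'a) \<Rightarrow> 'x \<Rightarrow> 'x) \<Rightarrow> 'x set \<Rightarrow> 'x set set" where
  "fs_pow S act X = {U. U \<subseteq> X \<and> (\<exists>B. finite B \<and> supports_set S act B U)}"

definition ultrafilter_on :: "'x set set \<Rightarrow> 'x set \<Rightarrow> 'x set set \<Rightarrow> bool" where
  "ultrafilter_on P X \<U> \<longleftrightarrow>
     \<U> \<subseteq> P \<and> X \<in> \<U> \<and> {} \<notin> \<U> \<and>
     (\<forall>U\<in>\<U>. \<forall>V\<in>\<U>. U \<inter> V \<in> \<U>) \<and>
     (\<forall>U\<in>\<U>. \<forall>V\<in>P. U \<subseteq> V \<longrightarrow> V \<in> \<U>) \<and>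
     (\<forall>U\<in>P. U \<in> \<U> \<or> X - U \<in> \<U>)"

definition stone_cech :: "('a, 'f, 'r, 'z) fo_structure_scheme \<Rightarrow> (('a \<Rightarrow> 'a) \<Rightarrow> 'x \<Rightarrow> 'x) \<Rightarrow> 'x set \<Rightarrow> 'x set set set" where
  "stone_cech S act X =
     {\<U>. ultrafilter_on (fs_pow S act X) X \<U> \<and>
          (\<exists>B. finite B \<and> (\<forall>\<pi>\<in>fix_grp S B. act_uf act \<pi> \<U> = \<U>))}"

text \<open>Free K-vector space F(Y) on a set Y: finitely supported formal finite linear
  combinations, i.e. functions Y -> K with finitely many nonzero values (such a
  combination is automatically finitely supported in the sense of atoms).\<close>
definition free_vs :: "'y set \<Rightarrow> ('y \<Rightarrow> 'k::field) set" where
  "free_vs Y = {v. finite {y. v y \<noteq> 0} \<and> {y. v y \<noteq> 0} \<subseteq> Y}"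

definition fs_funs :: "('a, 'f, 'r, 'z) fo_structure_scheme \<Rightarrow> (('a \<Rightarrow> 'a) \<Rightarrow> 'x \<Rightarrow> 'x) \<Rightarrow> 'x set \<Rightarrow> ('x \<Rightarrow> 'k::field) set" where
  "fs_funs S act X =
     {f. (\<forall>x. x \<notin> X \<longrightarrow> f x = 0) \<and>
         (\<exists>B. finite B \<and> (\<forall>\<pi>\<in>fix_grp S B. act_set act \<pi> X = X \<and> (\<forall>x\<in>X. f (act \<pi> x) = f x)))}"

definition fs_linear_iso :: "('a, 'f, 'r, 'z) fo_structure_scheme \<Rightarrow> (('a \<Rightarrow> 'a) \<Rightarrow> 'x \<Rightarrow> 'x) \<Rightarrow> 'x set \<Rightarrow>
    (('x set set \<Rightarrow> 'k::field) \<Rightarrow> ('x \<Rightarrow> 'k)) \<Rightarrow> bool" where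
  "fs_linear_iso S act X \<Phi> \<longleftrightarrow>
     (let F = free_vs (stone_cech S act X); KX = fs_funs S act X in
       bij_betw \<Phi> F KX \<and>
       (\<forall>v\<in>F. \<forall>w\<in>F. \<Phi> (\<lambda>u. v u + w u) = (\<lambda>x. \<Phi> v x + \<Phi> w x)) \<and>
       (\<forall>c. \<forall>v\<in>F. \<Phi> (\<lambda>u. c * v u) = (\<lambda>x. c * \<Phi> v x)) \<and>
       (\<exists>B. finite B \<and> (\<forall>\<pi>\<in>fix_grp S B. \<forall>v\<in>F. \<forall>x\<in>X.
            \<Phi> (\<lambda>u. v (act_uf act \<pi> u)) x = \<Phi> v (act \<pi> x))))"

end

(* Let U be an ultrafilter on X, let stab U be its stabilizer, and let core U be the unique stab U-orbit
   in X that belongs to U. The isomorphism sends U to the indicator function of core U; it is equivariant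
   because core is.

   Say V < U if V and U are distinct and core U belongs to V. If < is well-founded, then the indicators
   are linearly independent (evaluate a relation at a point of the core of a maximal U outside the other
   cores) and span (by well-founded induction every core is a good set, i.e. one whose supported subsets
   all have indicators in the span; if X were not good, an ultrafilter avoiding the ideal of good sets
   would contradict that its core is good).

   Omega-stability enters as: no family of nonempty supported sets is closed under splitting into two
   disjoint members, since the branches of such a tree would be uncountably many types. This yields
   atoms modulo every ideal, and it excludes long half graphs. The latter gives the nonforking property
   that any member E of U has finitely many stab U-translates covering core U. Hence, if V < U, some
   translate of V contains E and differs from U, so E splits; a set of ultrafilters without a minimal
   element would thus produce a perfect tree. No Morley rank is needed. *)

theory Submission
  imports Defs
begin

section \<open>Automorphisms and types of an omega-categorical structure\<close>

text \<open>There is no choice inside the model, so a basis of \<open>K^X\<close> indexed by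
  ultrafilters needs a set attached to each ultrafilter equivariantly. A member of least rank is not
  canonical; the orbit of a stabilizer is. The price is that \<open>stab\<close> is only an open
  subgroup of automorphisms, in general not the pointwise stabilizer of finitely many atoms, so the
  covering argument is made for open subgroups. Outside the model choice is free. The families in
  \<open>no_perfect_tree\<close> and the ideals in \<open>ex_atom_modulo_ideal\<close> consist of
  supported sets, but as collections they may be unsupported. This is what permits Zorn's lemma for
  invariant ideals and a tree built from an arbitrary set of ultrafilters. Finite support is
  regained from a single atom \<open>Z\<close> modulo an ideal \<open>I\<close> that is invariant
  under some \<open>fix_grp S B\<close>. Omega-categoricity enters through back-and-forth: it turns
  supported sets of tuples into formulas with parameters and keeps the number of orbits finite over
  every finite set of atoms. Elements of \<open>X\<close> need not be tuples, so they are coded by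
  the images of a support list.\<close>

lemma eval_trm_cong: "(\<And>i. i \<in> fv_trm t \<Longrightarrow> v i = w i) \<Longrightarrow> eval_trm S v t = eval_trm S w t"
proof (induction t)
  case (Fn f ts)
  then have "map (eval_trm S v) ts = map (eval_trm S w) ts" by (auto intro!: map_cong)
  then show ?case by (simp only: eval_trm.simps)
qed auto

lemma sat_cong: "(\<And>i. i \<in> fv_fm \<phi> \<Longrightarrow> v i = w i) \<Longrightarrow> sat S v \<phi> \<longleftrightarrow> sat S w \<phi>"
proof (induction \<phi> arbitrary: v w)
  case (Eq t u)
  then show ?case using eval_trm_cong[of t v w S] eval_trm_cong[of u v w S] by simp
next
  case (Rel R ts)
  then have "map (eval_trm S v) ts = map (eval_trm S w) ts"
    by (auto intro!: map_cong eval_trm_cong)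
  then show ?case by (simp only: sat.simps)
next
  case (Neg \<phi>)
  have "sat S v \<phi> \<longleftrightarrow> sat S w \<phi>" by (rule Neg.IH) (simp add: Neg.prems)
  then show ?case by simp
next
  case (Conj \<phi> \<psi>)
  have "sat S v \<phi> \<longleftrightarrow> sat S w \<phi>" "sat S v \<psi> \<longleftrightarrow> sat S w \<psi>"
    by (rule Conj.IH, simp add: Conj.prems)+
  then show ?case by simp
next
  case (Ex x \<phi>)
  have "sat S (v(x := a)) \<phi> \<longleftrightarrow> sat S (w(x := a)) \<phi>" for a
    by (rule Ex.IH) (use Ex.prems in auto)
  then show ?case by simp
qed

section \<open>Automorphisms and preservation of truth\<close>

lemma aut_id: "aut S id"
  by (simp add: aut_def)

lemma aut_comp:
  assumes "aut S \<pi>" "aut S \<sigma>"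
  shows "aut S (\<pi> \<circ> \<sigma>)"
proof -
  have "map (\<pi> \<circ> \<sigma>) xs = map \<pi> (map \<sigma> xs)" for xs by simp
  then show ?thesis using assms unfolding aut_def by (simp add: bij_comp del: map_map)
qed

lemma aut_inv:
  assumes "aut S \<pi>"
  shows "aut S (inv \<pi>)"
proof -
  have b: "bij \<pi>" using assms by (simp add: aut_def)
  have m: "map \<pi> (map (inv \<pi>) xs) = xs" for xs
    using b by (simp add: o_def bij_is_surj surj_f_inv_f)
  have "inv \<pi> (fn_int S f xs) = fn_int S f (map (inv \<pi>) xs)" if "length xs = fn_ar S f" for f xs
  proof -
    have "\<pi> (fn_int S f (map (inv \<pi>) xs)) = fn_int S f xs"
      using assms that m[of xs] by (simp add: aut_def)
    then show ?thesis using b by (metis bij_inv_eq_iff)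
  qed
  moreover have "map (inv \<pi>) xs \<in> rel_int S R \<longleftrightarrow> xs \<in> rel_int S R" if "length xs = rel_ar S R" for R xs
    using assms that m[of xs] unfolding aut_def by (metis length_map)
  ultimately show ?thesis using b by (simp add: aut_def bij_imp_bij_inv)
qed

lemma aut_inv_comp: "aut S \<pi> \<Longrightarrow> inv \<pi> \<circ> \<pi> = id" "aut S \<pi> \<Longrightarrow> \<pi> \<circ> inv \<pi> = id"
  by (simp_all add: aut_def bij_is_inj bij_is_surj surj_iff[THEN iffD1])

lemma eval_trm_aut:
  "aut S \<pi> \<Longrightarrow> wf_trm S t \<Longrightarrow> par_trm t = {} \<Longrightarrow> eval_trm S (\<pi> \<circ> v) t = \<pi> (eval_trm S v t)"
proof (induction t)
  case (Fn f ts)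
  then have "map (eval_trm S (\<pi> \<circ> v)) ts = map \<pi> (map (eval_trm S v) ts)"
    by (auto simp del: comp_apply simp: comp_apply[of \<pi> "eval_trm S v"])
  then show ?case using Fn.prems unfolding eval_trm.simps by (simp add: aut_def del: map_map)
qed auto

lemma sat_aut:
  "aut S \<pi> \<Longrightarrow> wf_fm S \<phi> \<Longrightarrow> par_fm \<phi> = {} \<Longrightarrow> sat S (\<pi> \<circ> v) \<phi> \<longleftrightarrow> sat S v \<phi>"
proof (induction \<phi> arbitrary: v)
  case (Eq t u)
  then have "inj \<pi>" by (simp add: aut_def bij_is_inj)
  then show ?case using Eq eval_trm_aut[of S \<pi> t v] eval_trm_aut[of S \<pi> u v]
    by (simp add: inj_eq del: comp_apply)
next
  case (Rel R ts)
  then have "map (eval_trm S (\<pi> \<circ> v)) ts = map \<pi> (map (eval_trm S v) ts)"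
    by (auto simp: eval_trm_aut)
  then show ?case using Rel.prems unfolding sat.simps by (simp add: aut_def del: map_map)
next
  case (Ex x \<phi>)
  have "surj \<pi>" using Ex.prems by (simp add: aut_def bij_is_surj)
  have "(\<pi> \<circ> v)(x := \<pi> a) = \<pi> \<circ> v(x := a)" for a by auto
  then have "sat S ((\<pi> \<circ> v)(x := \<pi> a)) \<phi> \<longleftrightarrow> sat S (v(x := a)) \<phi>" for a
    using Ex.IH[of "v(x := a)"] Ex.prems by (simp del: comp_apply fun_upd_apply)
  then show ?case using \<open>surj \<pi>\<close> by (metis sat.simps(5) surjD)
qed auto

section \<open>Isolated types of tuples\<close>

definition tp :: "('a, 'f, 'r, 'z) fo_structure_scheme \<Rightarrow> nat \<Rightarrow> 'a list \<Rightarrow> ('f, 'r, 'a) fm set" where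
  "tp S n xs = {\<phi>. fm_over S n {} \<phi> \<and> sat S (nth xs) \<phi>}"

lemma tp_in_types: "tp S n xs \<in> types S n {}"
  unfolding types_def complete_type_def tp_def by (auto simp: fm_over_def intro!: exI[of _ "nth xs"])

lemma finite_conj:
  assumes "finite F" "\<And>\<phi>. \<phi> \<in> F \<Longrightarrow> fm_over S n B \<phi>"
  shows "\<exists>\<psi>. fm_over S n B \<psi> \<and> (\<forall>v. sat S v \<psi> \<longleftrightarrow> (\<forall>\<phi>\<in>F. sat S v \<phi>))"
  using assms
proof (induction F rule: finite_induct)
  case empty
  \<comment> \<open>The empty conjunction must be a true formula without free variables, so that
    \<open>n = 0\<close> is covered; quantifying \<open>Var 0\<close> closes the equation.\<close>
  show ?case by (rule exI[of _ "Ex 0 (Eq (Var 0) (Var 0))"]) (simp add: fm_over_def)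
next
  case (insert \<phi> F)
  then obtain \<psi> where "fm_over S n B \<psi>" "\<forall>v. sat S v \<psi> \<longleftrightarrow> (\<forall>\<phi>\<in>F. sat S v \<phi>)" by auto
  then show ?case using insert.prems by (intro exI[of _ "Conj \<phi> \<psi>"]) (auto simp: fm_over_def)
qed

lemma finite_disj:
  assumes "finite F" "\<And>\<phi>. \<phi> \<in> F \<Longrightarrow> fm_over S n B \<phi>"
  shows "\<exists>\<psi>. fm_over S n B \<psi> \<and> (\<forall>v. sat S v \<psi> \<longleftrightarrow> (\<exists>\<phi>\<in>F. sat S v \<phi>))"
proof -
  have "finite (Neg ` F)" "\<And>\<phi>. \<phi> \<in> Neg ` F \<Longrightarrow> fm_over S n B \<phi>"
    using assms(1) by simp (use assms(2) in \<open>force simp: fm_over_def\<close>)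
  from finite_conj[OF this] obtain \<psi>
    where "fm_over S n B \<psi>" "\<forall>v. sat S v \<psi> \<longleftrightarrow> (\<forall>\<phi>\<in>Neg ` F. sat S v \<phi>)" by auto
  then show ?thesis by (intro exI[of _ "Neg \<psi>"]) (auto simp: fm_over_def)
qed

text \<open>Only finitely many types are realized, and each one other than that of \<open>xs\<close>
  is excluded by a single formula true at \<open>xs\<close>; the conjunction of these formulas
  isolates the type.\<close>

lemma isolating_formula:
  assumes fin: "finite (types S n {})"
  shows "\<exists>\<phi>. fm_over S n {} \<phi> \<and> sat S (nth xs) \<phi> \<and> (\<forall>ys. sat S (nth ys) \<phi> \<longrightarrow> tp S n ys = tp S n xs)"
proof -
  let ?K = "range (tp S n) - {tp S n xs}"
  have K: "finite ?K"
    by (rule finite_subset[OF _ fin]) (auto intro: tp_in_types)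
  have "\<exists>\<phi>. fm_over S n {} \<phi> \<and> \<phi> \<in> tp S n xs \<and> \<phi> \<notin> q" if qK: "q \<in> ?K" for q
  proof -
    obtain ys where q: "q = tp S n ys" "tp S n ys \<noteq> tp S n xs" using qK by blast
    then obtain \<phi> where p: "fm_over S n {} \<phi>" "sat S (nth ys) \<phi> \<noteq> sat S (nth xs) \<phi>"
      unfolding tp_def by auto
    show ?thesis
    proof (cases "sat S (nth xs) \<phi>")
      case True
      then show ?thesis using p q by (intro exI[of _ \<phi>]) (auto simp: tp_def)
    next
      case False
      then show ?thesis using p q by (intro exI[of _ "Neg \<phi>"]) (auto simp: tp_def fm_over_def)
    qed
  qed
  then obtain h where h: "\<And>q. q \<in> ?K \<Longrightarrow> fm_over S n {} (h q) \<and> h q \<in> tp S n xs \<and> h q \<notin> q"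
    by metis
  have "finite (h ` ?K)" "\<And>\<phi>. \<phi> \<in> h ` ?K \<Longrightarrow> fm_over S n {} \<phi>" using K h by auto
  from finite_conj[OF this] obtain \<psi>
    where psi: "fm_over S n {} \<psi>" "\<forall>v. sat S v \<psi> \<longleftrightarrow> (\<forall>\<phi>\<in>h ` ?K. sat S v \<phi>)" by auto
  have "sat S (nth xs) \<psi>" using psi h by (auto simp: tp_def)
  moreover have "tp S n ys = tp S n xs" if "sat S (nth ys) \<psi>" for ys
  proof (rule ccontr)
    assume "tp S n ys \<noteq> tp S n xs"
    then have "tp S n ys \<in> ?K" by auto
    then show False using h[of "tp S n ys"] psi(2) that by (auto simp: tp_def)
  qed
  ultimately show ?thesis using psi(1) by blast
qed

lemma sat_nth_append:
  assumes "fm_over S (Suc n) B \<phi>" "length xs = n"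
  shows "sat S ((nth xs)(n := c)) \<phi> \<longleftrightarrow> sat S (nth (xs @ [c])) \<phi>"
  by (rule sat_cong) (use assms in \<open>auto simp: fm_over_def nth_append\<close>)

text \<open>One step of back-and-forth. The formula isolating the type of the longer tuple,
  quantified over its last variable, lies in the common type of \<open>xs\<close> and
  \<open>ys\<close>; a witness on the side of \<open>ys\<close> is the required
  \<open>d\<close>.\<close>

lemma tp_extend:
  assumes fin: "finite (types S (Suc n) {})"
    and len: "length xs = n" "length ys = n" and eq: "tp S n xs = tp S n ys"
  shows "\<exists>d. tp S (Suc n) (xs @ [c]) = tp S (Suc n) (ys @ [d])"
proof -
  obtain \<phi> where p: "fm_over S (Suc n) {} \<phi>" "sat S (nth (xs @ [c])) \<phi>"
      "\<And>zs. sat S (nth zs) \<phi> \<Longrightarrow> tp S (Suc n) zs = tp S (Suc n) (xs @ [c])"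
    using isolating_formula[OF fin, of "xs @ [c]"] by blast
  have "fm_over S n {} (Ex n \<phi>)" using p(1) by (auto simp: fm_over_def)
  moreover have "sat S (nth xs) (Ex n \<phi>)"
    using p(2) sat_nth_append[OF p(1) len(1), of c] by auto
  ultimately have "Ex n \<phi> \<in> tp S n ys" unfolding eq[symmetric] by (simp add: tp_def)
  then have "sat S (nth ys) (Ex n \<phi>)" by (simp add: tp_def)
  then obtain d where "sat S (nth (ys @ [d])) \<phi>"
    using sat_nth_append[OF p(1) len(2)] by auto
  then show ?thesis using p(3) by metis
qed

section \<open>Homogeneity by back-and-forth\<close>

lemma aut_of_enumerations:
  assumes surj: "surj X" "surj Y"
    and sat: "\<And>\<phi>. wf_fm S \<phi> \<Longrightarrow> par_fm \<phi> = {} \<Longrightarrow> sat S X \<phi> \<longleftrightarrow> sat S Y \<phi>"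
  shows "\<exists>\<pi>. aut S \<pi> \<and> (\<forall>i. \<pi> (X i) = Y i)"
proof -
  have eq: "X i = X j \<longleftrightarrow> Y i = Y j" for i j
    using sat[of "Eq (Var i) (Var j)"] by simp
  \<comment> \<open>The enumerations may repeat atoms. Comparing the equations
    \<open>X i = X j\<close> and \<open>Y i = Y j\<close> shows that the choice of the index is
    immaterial.\<close>
  define \<pi> where "\<pi> a = Y (SOME i. X i = a)" for a
  have pi: "\<pi> (X i) = Y i" for i
    unfolding \<pi>_def using eq by (metis (mono_tags, lifting) someI)
  have ex: "\<exists>is. map X is = xs" for xs
    using surj(1) by (metis ex_map_conv surjD)
  have "inj \<pi>" using surj(1) pi eq unfolding inj_def by (metis surjD)
  moreover have "surj \<pi>" using surj pi by (metis surj_def)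
  moreover have "\<pi> (fn_int S f xs) = fn_int S f (map \<pi> xs)" if len: "length xs = fn_ar S f" for f xs
  proof -
    obtain "is" where i: "map X is = xs" using ex by blast
    obtain j where j: "X j = fn_int S f xs" using surj(1) by (metis surjD)
    have "sat S X (Eq (Var j) (Fn f (map Var is)))"
      using i j by (auto simp: o_def)
    then have "sat S Y (Eq (Var j) (Fn f (map Var is)))"
      using sat[of "Eq (Var j) (Fn f (map Var is))"] len i by auto
    then have "Y j = fn_int S f (map Y is)" by (simp add: o_def)
    then show ?thesis using pi i j by (metis (mono_tags, lifting) comp_apply list.map_comp map_eq_conv)
  qed
  moreover have "map \<pi> xs \<in> rel_int S R \<longleftrightarrow> xs \<in> rel_int S R" if len: "length xs = rel_ar S R" for R xs
  proof -
    obtain "is" where i: "map X is = xs" using ex by blast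
    have "sat S X (Rel R (map Var is)) \<longleftrightarrow> sat S Y (Rel R (map Var is))"
      by (rule sat) (use len i in auto)
    then have "map X is \<in> rel_int S R \<longleftrightarrow> map Y is \<in> rel_int S R" by (simp add: o_def)
    moreover have "map \<pi> xs = map Y is" using i pi by auto
    ultimately show ?thesis using i by simp
  qed
  ultimately show ?thesis using pi unfolding aut_def bij_def by blast
qed

lemma fm_over_bound:
  assumes "wf_fm S \<phi>" "par_fm \<phi> = {}"
  shows "\<exists>m. fm_over S m {} \<phi>"
proof -
  have t: "finite (fv_trm t)" for t :: "('f,'a) trm" by (induction t) auto
  have "finite (fv_fm \<phi>)" by (induction \<phi>) (auto simp: t)
  then obtain m where "fv_fm \<phi> \<subseteq> {..<m}" by (metis finite_nat_iff_bounded)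
  then show ?thesis using assms by (auto simp: fm_over_def)
qed

text \<open>\<open>tp_extend\<close> lengthens a pair of tuples of equal type on either side, and
  since the universe is countable the limit of such extensions enumerates it twice.\<close>

theorem tp_eq_imp_aut:
  fixes S :: "('a, 'f, 'r, 'z) fo_structure_scheme"
  assumes cnt: "countable (UNIV :: 'a set)" and cat: "omega_categorical S"
    and len: "length xs = n" "length ys = n" and eq: "tp S n xs = tp S n ys"
  shows "\<exists>\<pi>. aut S \<pi> \<and> map \<pi> xs = ys"
proof -
  have fin: "finite (types S m {})" for m using cat by (simp add: omega_categorical_def)
  define e where "e = from_nat_into (UNIV :: 'a set)"
  have e: "surj e" unfolding e_def using cnt by (simp add: range_from_nat_into)
  \<comment> \<open>Stage \<open>k\<close> puts the atom \<open>e k\<close> into both lists: on the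
    left with a partner \<open>w\<close>, then on the right with a partner \<open>u\<close>. This
    gives two entries per stage. The clause for \<open>k = 0\<close> anchors the sequence at the
    given tuples.\<close>
  let ?P = "\<lambda>k s. length (fst s) = n + 2*k \<and> length (snd s) = n + 2*k \<and>
     tp S (n+2*k) (fst s) = tp S (n+2*k) (snd s) \<and> (k = 0 \<longrightarrow> s = (xs, ys))"
  let ?Q = "\<lambda>k s s'. \<exists>u w. fst s' = fst s @ [e k, u] \<and> snd s' = snd s @ [w, e k]"
  have "\<exists>f. \<forall>k. ?P k (f k) \<and> ?Q k (f k) (f (Suc k))"
  proof (rule dependent_nat_choice)
    show "\<exists>s. ?P 0 s" using len eq by auto
    fix s k assume P: "?P k s"
    obtain w where w: "tp S (Suc (n+2*k)) (fst s @ [e k]) = tp S (Suc (n+2*k)) (snd s @ [w])"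
      using tp_extend[OF fin, of "fst s" "n+2*k" "snd s" "e k"] P by auto
    obtain u where u: "tp S (Suc (Suc (n+2*k))) ((snd s @ [w]) @ [e k]) = tp S (Suc (Suc (n+2*k))) ((fst s @ [e k]) @ [u])"
      using tp_extend[OF fin _ _ w[symmetric], of "e k"] P by auto
    show "\<exists>s'. ?P (Suc k) s' \<and> ?Q k s s'"
      by (rule exI[of _ "(fst s @ [e k, u], snd s @ [w, e k])"]) (use P u in auto)
  qed
  then obtain f where P: "\<And>k. ?P k (f k)" and Q: "\<And>k. ?Q k (f k) (f (Suc k))" by blast
  have ext: "\<exists>u w. fst (f (k + j)) = fst (f k) @ u \<and> snd (f (k + j)) = snd (f k) @ w" for k j
  proof (induction j)
    case (Suc j)
    then show ?case using Q[of "k+j"] by auto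
  qed auto
  \<comment> \<open>Stage \<open>Suc i\<close> is long enough to have an entry at position
    \<open>i\<close> even for \<open>n = 0\<close>, and later stages only append, so this entry is
    final.\<close>
  define X where "X i = fst (f (Suc i)) ! i" for i
  define Y where "Y i = snd (f (Suc i)) ! i" for i
  have XY: "fst (f k) ! i = X i \<and> snd (f k) ! i = Y i" if "i < n + 2*k" for i k
  proof (cases "k \<le> Suc i")
    case True
    then obtain j where "Suc i = k + j" by (metis le_add_diff_inverse)
    then show ?thesis unfolding X_def Y_def
      using ext[of k j] P[of k] that by (auto simp: nth_append)
  next
    case False
    then obtain j where "k = Suc i + j" by (metis le_add_diff_inverse nat_le_linear)
    then show ?thesis unfolding X_def Y_def
      using ext[of "Suc i" j] P[of "Suc i"] that by (auto simp: nth_append)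
  qed
  have "\<exists>i. X i = e k" for k
  proof -
    obtain u where "fst (f (Suc k)) = fst (f k) @ [e k, u]" using Q[of k] by auto
    then have "fst (f (Suc k)) ! (n + 2*k) = e k" using P[of k] by (metis nth_append_length)
    then show ?thesis using XY[of "n+2*k" "Suc k"] by auto
  qed
  then have sX: "surj X" using e by (metis surj_def)
  have "\<exists>i. Y i = e k" for k
  proof -
    obtain w where "snd (f (Suc k)) = (snd (f k) @ [w]) @ [e k]" using Q[of k] by auto
    moreover have "length (snd (f k) @ [w]) = Suc (n+2*k)" using P[of k] by simp
    ultimately have "snd (f (Suc k)) ! (Suc (n + 2*k)) = e k" by (metis nth_append_length)
    then show ?thesis using XY[of "Suc (n+2*k)" "Suc k"] by auto
  qed
  then have sY: "surj Y" using e by (metis surj_def)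
  \<comment> \<open>A formula sees only finitely many entries, so the equality of types at one
    finite stage decides it.\<close>
  have "sat S X \<phi> \<longleftrightarrow> sat S Y \<phi>" if phi: "wf_fm S \<phi>" "par_fm \<phi> = {}" for \<phi>
  proof -
    obtain m where m: "fm_over S m {} \<phi>" using fm_over_bound[OF phi] by blast
    then have m': "fm_over S (n+2*m) {} \<phi>" by (auto simp: fm_over_def)
    have "sat S X \<phi> \<longleftrightarrow> sat S (nth (fst (f m))) \<phi>"
      by (rule sat_cong) (use m' XY[of _ m] in \<open>auto simp: fm_over_def\<close>)
    moreover have "sat S Y \<phi> \<longleftrightarrow> sat S (nth (snd (f m))) \<phi>"
      by (rule sat_cong) (use m' XY[of _ m] in \<open>auto simp: fm_over_def\<close>)
    moreover have "tp S (n+2*m) (fst (f m)) = tp S (n+2*m) (snd (f m))" using P by blast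
    ultimately show ?thesis using m' by (auto simp: tp_def)
  qed
  then obtain \<pi> where pi: "aut S \<pi>" "\<And>i. \<pi> (X i) = Y i"
    using aut_of_enumerations[OF sX sY, of S] by blast
  have "f 0 = (xs, ys)" using P by blast
  then have "\<pi> (xs ! i) = ys ! i" if "i < n" for i
    using XY[of i 0] that pi(2)[of i] by auto
  then have "map \<pi> xs = ys" using len by (auto intro: nth_equalityI)
  then show ?thesis using pi(1) by blast
qed

section \<open>Invariant sets of tuples are definable\<close>

lemma tp_aut:
  assumes "aut S \<pi>" "length xs = n"
  shows "tp S n (map \<pi> xs) = tp S n xs"
proof -
  have "sat S (nth (map \<pi> xs)) \<phi> \<longleftrightarrow> sat S (nth xs) \<phi>" if "fm_over S n {} \<phi>" for \<phi>
  proof -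
    have "sat S (nth (map \<pi> xs)) \<phi> \<longleftrightarrow> sat S (\<pi> \<circ> nth xs) \<phi>"
      by (rule sat_cong) (use that assms(2) in \<open>auto simp: fm_over_def\<close>)
    then show ?thesis using sat_aut[OF assms(1), of \<phi>] that by (auto simp: fm_over_def)
  qed
  then show ?thesis by (auto simp: tp_def)
qed

text \<open>By homogeneity an invariant set contains, with a tuple of length \<open>n\<close>, every
  tuple of that length and type. It is therefore a union of finitely many classes, each cut out by
  an isolating formula.\<close>

lemma aut_invariant_definable:
  fixes S :: "('a, 'f, 'r, 'z) fo_structure_scheme"
  assumes cnt: "countable (UNIV :: 'a set)" and cat: "omega_categorical S"
    and inv: "\<And>\<pi> xs. aut S \<pi> \<Longrightarrow> xs \<in> Y \<Longrightarrow> map \<pi> xs \<in> Y"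
  shows "\<exists>\<phi>. fm_over S n {} \<phi> \<and> (\<forall>xs. length xs = n \<longrightarrow> (sat S (nth xs) \<phi> \<longleftrightarrow> xs \<in> Y))"
proof -
  have fin: "finite (types S n {})" using cat by (simp add: omega_categorical_def)
  let ?L = "{xs. length xs = n}"
  have "\<exists>\<phi>. fm_over S n {} \<phi> \<and> (\<forall>ys. sat S (nth ys) \<phi> \<longleftrightarrow> tp S n ys = q)" if "q \<in> tp S n ` (Y \<inter> ?L)" for q
  proof -
    obtain xs where "q = tp S n xs" using \<open>q \<in> _\<close> by auto
    moreover obtain \<phi> where phi: "fm_over S n {} \<phi>" "sat S (nth xs) \<phi>"
      "\<And>ys. sat S (nth ys) \<phi> \<Longrightarrow> tp S n ys = tp S n xs" using isolating_formula[OF fin] by blast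
    moreover have "sat S (nth ys) \<phi>" if "tp S n ys = tp S n xs" for ys
      using phi(1,2) that by (auto simp: tp_def)
    ultimately show ?thesis by blast
  qed
  then obtain h where h: "\<And>q. q \<in> tp S n ` (Y \<inter> ?L) \<Longrightarrow> fm_over S n {} (h q)"
      "\<And>q ys. q \<in> tp S n ` (Y \<inter> ?L) \<Longrightarrow> sat S (nth ys) (h q) \<longleftrightarrow> tp S n ys = q" by metis
  have "finite (tp S n ` (Y \<inter> ?L))" by (rule finite_subset[OF _ fin]) (auto intro: tp_in_types)
  then have "finite (h ` tp S n ` (Y \<inter> ?L))" by blast
  from finite_disj[OF this, of S n "{}"] h(1) obtain \<psi> where psi: "fm_over S n {} \<psi>"
      "\<forall>v. sat S v \<psi> \<longleftrightarrow> (\<exists>\<phi>\<in>h ` tp S n ` (Y \<inter> ?L). sat S v \<phi>)" by blast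
  have "sat S (nth xs) \<psi> \<longleftrightarrow> xs \<in> Y" if lenx: "length xs = n" for xs
  proof -
    have "sat S (nth xs) \<psi> \<longleftrightarrow> (\<exists>q\<in>tp S n ` (Y \<inter> ?L). sat S (nth xs) (h q))" using psi(2) by simp
    also have "\<dots> \<longleftrightarrow> (\<exists>q\<in>tp S n ` (Y \<inter> ?L). tp S n xs = q)" by (rule bex_cong[OF refl]) (rule h(2))
    also have "\<dots> \<longleftrightarrow> (\<exists>ys\<in>Y \<inter> ?L. tp S n xs = tp S n ys)" by blast
    also have "\<dots> \<longleftrightarrow> xs \<in> Y"
    proof
      assume "\<exists>ys\<in>Y \<inter> ?L. tp S n xs = tp S n ys"
      then obtain ys where "ys \<in> Y" "length ys = n" "tp S n ys = tp S n xs" by force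
      then obtain \<pi> where "aut S \<pi>" "map \<pi> ys = xs" "ys \<in> Y"
        using tp_eq_imp_aut[OF cnt cat _ lenx, of ys] by auto
      then show "xs \<in> Y" using inv by blast
    qed (use that in auto)
    finally show ?thesis .
  qed
  then show ?thesis using psi(1) by blast
qed

text \<open>Parameters are plugged in without substitution: the variable \<open>n\<close> is forced
  to be the atom \<open>a\<close> by an equation under an existential quantifier, one parameter at a
  time.\<close>

lemma bind_parameters:
  assumes "fm_over S (n + length c) UNIV \<psi>"
  shows "\<exists>\<phi>. fm_over S n UNIV \<phi> \<and> (\<forall>xs. length xs = n \<longrightarrow> (sat S (nth xs) \<phi> \<longleftrightarrow> sat S (nth (xs @ c)) \<psi>))"
  using assms
proof (induction c arbitrary: n)
  case (Cons a c)
  have "fm_over S (Suc n + length c) UNIV \<psi>" using Cons.prems by simp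
  from Cons.IH[OF this] obtain \<phi> where phi: "fm_over S (Suc n) UNIV \<phi>"
    "\<And>xs. length xs = Suc n \<Longrightarrow> (sat S (nth xs) \<phi> \<longleftrightarrow> sat S (nth (xs @ c)) \<psi>)"
    by blast
  show ?case
  proof (intro exI conjI allI impI)
    show "fm_over S n UNIV (Ex n (Conj (Eq (Var n) (Par a)) \<phi>))"
      using phi(1) by (auto simp: fm_over_def)
    fix xs :: "'a list" assume "length xs = n"
    then show "sat S (nth xs) (Ex n (Conj (Eq (Var n) (Par a)) \<phi>)) \<longleftrightarrow> sat S (nth (xs @ a # c)) \<psi>"
      using sat_nth_append[OF phi(1), of xs a] phi(2)[of "xs @ [a]"] by simp
  qed
qed auto

section \<open>Pointwise stabilizers and supported sets of tuples\<close>

lemma fix_grp_set: "\<pi> \<in> fix_grp S (set c) \<longleftrightarrow> aut S \<pi> \<and> map \<pi> c = c"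
  using map_eq_conv[of \<pi> c id] by (auto simp: fix_grp_def)

lemma fix_grp_aut: "\<pi> \<in> fix_grp S B \<Longrightarrow> aut S \<pi>"
  by (simp add: fix_grp_def)

lemma fix_grp_inv:
  assumes "\<pi> \<in> fix_grp S B" shows "inv \<pi> \<in> fix_grp S B"
proof -
  have "inv \<pi> a = a" if "a \<in> B" for a
    using assms that unfolding fix_grp_def aut_def by (metis (mono_tags, lifting) bij_inv_eq_iff mem_Collect_eq)
  then show ?thesis using assms aut_inv by (auto simp: fix_grp_def)
qed

lemma fix_grp_comp: "\<pi> \<in> fix_grp S B \<Longrightarrow> \<sigma> \<in> fix_grp S B \<Longrightarrow> \<pi> \<circ> \<sigma> \<in> fix_grp S B"
  by (auto simp: fix_grp_def aut_comp)

lemma fix_grp_mono: "B \<subseteq> C \<Longrightarrow> fix_grp S C \<subseteq> fix_grp S B"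
  by (auto simp: fix_grp_def)

lemma supported_tuples_definable:
  fixes S :: "('a, 'f, 'r, 'z) fo_structure_scheme"
  assumes cnt: "countable (UNIV :: 'a set)" and cat: "omega_categorical S"
    and C: "finite C" and inv: "\<And>\<pi> xs. \<pi> \<in> fix_grp S C \<Longrightarrow> xs \<in> Y \<Longrightarrow> map \<pi> xs \<in> Y"
  shows "\<exists>\<phi>. fm_over S n UNIV \<phi> \<and> (\<forall>v. sat S v \<phi> \<longleftrightarrow> map v [0..<n] \<in> Y)"
proof -
  obtain c where c: "set c = C" using C finite_list by blast
  \<comment> \<open>Append an enumeration \<open>c\<close> of the support and close under all
    automorphisms. The fibre over \<open>c\<close> is again \<open>Y\<close>, because an
    automorphism mapping \<open>c\<close> to itself entrywise lies in \<open>fix_grp S C\<close>.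
    The closure is definable without parameters, and \<open>c\<close> is then put back in as
    parameters.\<close>
  let ?Y = "{map \<pi> (xs @ c) | \<pi> xs. aut S \<pi> \<and> xs \<in> Y}"
  have Y: "xs @ c \<in> ?Y \<longleftrightarrow> xs \<in> Y" for xs
  proof
    assume "xs @ c \<in> ?Y"
    then obtain \<pi> ys where p: "xs @ c = map \<pi> ys @ map \<pi> c" "aut S \<pi>" "ys \<in> Y" by auto
    then have "map \<pi> ys = xs" "map \<pi> c = c"
      using append_eq_append_conv[of xs "map \<pi> ys" c "map \<pi> c"] by simp_all
    moreover have "\<pi> \<in> fix_grp S C" using p(2) \<open>map \<pi> c = c\<close> fix_grp_set c by blast
    ultimately show "xs \<in> Y" using inv p(3) by blast
  next
    assume "xs \<in> Y"
    then show "xs @ c \<in> ?Y" using aut_id by (metis (mono_tags, lifting) list.map_id mem_Collect_eq)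
  qed
  have "map \<pi> zs \<in> ?Y" if s: "aut S \<pi>" "zs \<in> ?Y" for \<pi> zs
  proof -
    obtain \<sigma> xs where z: "zs = map \<sigma> (xs @ c)" "aut S \<sigma>" "xs \<in> Y" using s(2) by blast
    then have "map \<pi> zs = map (\<pi> \<circ> \<sigma>) (xs @ c)" "aut S (\<pi> \<circ> \<sigma>)" using s(1) aut_comp by auto
    then show ?thesis using z(3) by blast
  qed
  then obtain \<psi> where psi: "fm_over S (n + length c) {} \<psi>"
     "\<And>xs. length xs = n + length c \<Longrightarrow> (sat S (nth xs) \<psi> \<longleftrightarrow> xs \<in> ?Y)"
    using aut_invariant_definable[OF cnt cat, of ?Y "n + length c"] by blast
  have "fm_over S (n + length c) UNIV \<psi>" using psi(1) by (auto simp: fm_over_def)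
  then obtain \<phi> where phi: "fm_over S n UNIV \<phi>"
      "\<And>xs. length xs = n \<Longrightarrow> (sat S (nth xs) \<phi> \<longleftrightarrow> sat S (nth (xs @ c)) \<psi>)"
    using bind_parameters by blast
  have "sat S v \<phi> \<longleftrightarrow> map v [0..<n] \<in> Y" for v
  proof -
    have "sat S v \<phi> \<longleftrightarrow> sat S (nth (map v [0..<n])) \<phi>"
      by (rule sat_cong) (use phi(1) in \<open>auto simp: fm_over_def\<close>)
    also have "\<dots> \<longleftrightarrow> map v [0..<n] @ c \<in> ?Y" using phi(2) psi(2) by simp
    also have "\<dots> \<longleftrightarrow> map v [0..<n] \<in> Y" by (rule Y)
    finally show ?thesis .
  qed
  then show ?thesis using phi(1) by blast
qed

text \<open>With \<open>c\<close> enumerating \<open>C\<close>, two tuples are in one orbit over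
  \<open>C\<close> exactly when they have the same type after \<open>c\<close> is appended to both,
  and there are finitely many such types.\<close>

lemma finite_tuple_orbits:
  fixes S :: "('a, 'f, 'r, 'z) fo_structure_scheme"
  assumes cnt: "countable (UNIV :: 'a set)" and cat: "omega_categorical S" and C: "finite C"
  shows "finite (orbit S map C ` {xs. length xs = n})"
proof -
  obtain c where c: "set c = C" using C finite_list by blast
  have fin: "finite (types S (n + length c) {})" using cat by (simp add: omega_categorical_def)
  have eq: "orbit S map C xs = {ys. length ys = n \<and> tp S (n + length c) (ys @ c) = tp S (n + length c) (xs @ c)}"
    if len: "length xs = n" for xs
  proof (intro set_eqI iffI)
    fix ys assume "ys \<in> orbit S map C xs"
    then obtain \<pi> where p: "\<pi> \<in> fix_grp S C" "ys = map \<pi> xs" by (auto simp: orbit_def)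
    then have "ys @ c = map \<pi> (xs @ c)" using c fix_grp_set[of \<pi> S c] by auto
    then show "ys \<in> {ys. length ys = n \<and> tp S (n + length c) (ys @ c) = tp S (n + length c) (xs @ c)}"
      using tp_aut[of S \<pi> "xs @ c"] p len fix_grp_aut by fastforce
  next
    fix ys assume "ys \<in> {ys. length ys = n \<and> tp S (n + length c) (ys @ c) = tp S (n + length c) (xs @ c)}"
    then obtain \<pi> where p: "aut S \<pi>" "map \<pi> (xs @ c) = ys @ c" "length ys = n"
      using tp_eq_imp_aut[OF cnt cat, of "xs @ c" "n + length c" "ys @ c"] len by auto
    then have "map \<pi> xs = ys" "map \<pi> c = c" using len by auto
    then have "\<pi> \<in> fix_grp S C" using p(1) c fix_grp_set by blast
    then show "ys \<in> orbit S map C xs" using \<open>map \<pi> xs = ys\<close> by (auto simp: orbit_def)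
  qed
  have "orbit S map C ` {xs. length xs = n} \<subseteq>
      (\<lambda>q. {ys. length ys = n \<and> tp S (n + length c) (ys @ c) = q}) ` types S (n + length c) {}"
    using eq tp_in_types by fastforce
  then show ?thesis using fin finite_surj by blast
qed

section \<open>Definable sets with atoms\<close>

locale nominal =
  fixes S :: "('a, 'f, 'r) fo_structure" and act :: "('a \<Rightarrow> 'a) \<Rightarrow> 'x \<Rightarrow> 'x"
  assumes zfa: "zfa_universe S act"
begin

lemma act_id [simp]: "act id x = x"
  using zfa by (simp add: zfa_universe_def)

lemma orbit_self: "x \<in> orbit S act B x"
proof -
  have "id \<in> fix_grp S B" by (simp add: fix_grp_def aut_id)
  then show ?thesis unfolding orbit_def using act_id by (metis (mono_tags, lifting) mem_Collect_eq)
qed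

lemma act_comp: "aut S \<pi> \<Longrightarrow> aut S \<sigma> \<Longrightarrow> act (\<pi> \<circ> \<sigma>) x = act \<pi> (act \<sigma> x)"
  using zfa unfolding zfa_universe_def by blast

lemma act_inv_left [simp]: "aut S \<pi> \<Longrightarrow> act (inv \<pi>) (act \<pi> x) = x"
  by (metis act_comp act_id aut_inv aut_inv_comp(1))

lemma act_inv_right [simp]: "aut S \<pi> \<Longrightarrow> act \<pi> (act (inv \<pi>) x) = x"
  by (metis act_comp act_id aut_inv aut_inv_comp(2))

lemma act_eq_iff: "aut S \<pi> \<Longrightarrow> act \<pi> x = act \<pi> y \<longleftrightarrow> x = y"
  by (metis act_inv_left)

lemma ex_supp_list: "\<exists>b. \<forall>\<pi>\<in>fix_grp S (set b). act \<pi> x = x"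
  using zfa unfolding zfa_universe_def by (metis finite_list)

text \<open>The two automorphisms differ by one that fixes \<open>b\<close>. Thus an element of the
  orbit of \<open>x\<close> is coded by a tuple, the image of a support list; this is how formulas
  come to speak about \<open>X\<close>.\<close>

lemma act_eq_if_map_eq:
  assumes "\<forall>\<pi>\<in>fix_grp S (set b). act \<pi> x = x" "aut S \<pi>" "aut S \<sigma>" "map \<pi> b = map \<sigma> b"
  shows "act \<pi> x = act \<sigma> x"
proof -
  have "map (inv \<sigma> \<circ> \<pi>) b = map (inv \<sigma> \<circ> \<sigma>) b" using assms(4) by (metis map_map)
  then have "inv \<sigma> \<circ> \<pi> \<in> fix_grp S (set b)"
    using assms(2,3) aut_comp aut_inv aut_inv_comp(1) fix_grp_set[of "inv \<sigma> \<circ> \<pi>" S b] by (metis list.map_id)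
  then have "act (inv \<sigma> \<circ> \<pi>) x = x" using assms(1) by blast
  then have "act (inv \<sigma>) (act \<pi> x) = x" using act_comp[OF aut_inv[OF assms(3)] assms(2)] by simp
  then show ?thesis using assms(3) by (metis act_inv_right)
qed

lemma mem_image_act: "aut S \<pi> \<Longrightarrow> x \<in> act \<pi> ` U \<longleftrightarrow> act (inv \<pi>) x \<in> U"
  by (metis (no_types, lifting) act_inv_left act_inv_right image_iff)

lemma image_act_comp: "aut S \<pi> \<Longrightarrow> aut S \<sigma> \<Longrightarrow> act (\<pi> \<circ> \<sigma>) ` U = act \<pi> ` act \<sigma> ` U"
  by (simp add: image_image act_comp)

lemma image_act_inv [simp]:
  "aut S \<pi> \<Longrightarrow> act (inv \<pi>) ` act \<pi> ` U = U" "aut S \<pi> \<Longrightarrow> act \<pi> ` act (inv \<pi>) ` U = U"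
  by (simp_all add: image_image cong: image_cong)

lemma inj_act: "aut S \<pi> \<Longrightarrow> inj (act \<pi>)"
  by (simp add: inj_def act_eq_iff)

lemma supports_setI:
  assumes "\<And>\<pi> x. \<pi> \<in> fix_grp S B \<Longrightarrow> x \<in> U \<Longrightarrow> act \<pi> x \<in> U"
  shows "supports_set S act B U"
  unfolding supports_set_def act_set_def
proof (intro ballI equalityI subsetI)
  fix \<pi> x assume p: "\<pi> \<in> fix_grp S B" and "x \<in> U"
  then show "x \<in> act \<pi> ` U"
    using assms[OF fix_grp_inv[OF p]] mem_image_act[OF fix_grp_aut[OF p]] by blast
qed (use assms in auto)

lemma supports_setD: "supports_set S act B U \<Longrightarrow> \<pi> \<in> fix_grp S B \<Longrightarrow> act \<pi> ` U = U"
  by (simp add: supports_set_def act_set_def)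

lemma supports_set_mem: "supports_set S act B U \<Longrightarrow> \<pi> \<in> fix_grp S B \<Longrightarrow> act \<pi> x \<in> U \<longleftrightarrow> x \<in> U"
  by (metis supports_setD inj_act fix_grp_aut inj_image_mem_iff)

lemma supports_set_mono: "supports_set S act B U \<Longrightarrow> B \<subseteq> C \<Longrightarrow> supports_set S act C U"
  using fix_grp_mono[of B C S] unfolding supports_set_def by blast

lemma supports_set_image:
  assumes "supports_set S act B U" "aut S \<pi>"
  shows "supports_set S act (\<pi> ` B) (act \<pi> ` U)"
proof (rule supports_setI)
  fix \<sigma> y assume s: "\<sigma> \<in> fix_grp S (\<pi> ` B)" and "y \<in> act \<pi> ` U"
  then obtain x where x: "x \<in> U" "y = act \<pi> x" by auto
  have a: "aut S \<sigma>" using s fix_grp_aut by blast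
  have i: "inv \<pi> (\<pi> a) = a" for a using assms(2) by (simp add: aut_def bij_is_inj)
  have "inv \<pi> \<circ> (\<sigma> \<circ> \<pi>) \<in> fix_grp S B"
    using s assms(2) a i by (auto simp: fix_grp_def intro!: aut_comp aut_inv)
  then have "act (inv \<pi> \<circ> (\<sigma> \<circ> \<pi>)) x \<in> U" using supports_set_mem assms(1) x by blast
  then show "act \<sigma> y \<in> act \<pi> ` U"
    using a assms(2) x by (simp add: mem_image_act act_comp aut_inv aut_comp)
qed

end

text \<open>This instance lets the translates of a supported set be indexed by tuples, so that the
  theory of definable sets applies to the index set too.\<close>

lemma nominal_map: "nominal S map"
proof
  have "\<forall>\<pi>\<in>fix_grp S (set xs). map \<pi> xs = xs" for xs by (simp add: fix_grp_set)
  then show "zfa_universe S map" unfolding zfa_universe_def by (auto intro: exI[of _ "set _"])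
qed

locale definable_nominal = nominal S act
  for S :: "('a, 'f, 'r) fo_structure" and act :: "('a \<Rightarrow> 'a) \<Rightarrow> 'x \<Rightarrow> 'x" +
  fixes A0 :: "'a set" and X :: "'x set"
  assumes cnt: "countable (UNIV :: 'a set)" and cat: "omega_categorical S" and stable: "omega_stable S"
    and fin_A0: "finite A0" and supp_X: "supports_set S act A0 X" and fin_orb: "finite (orbit S act A0 ` X)"
begin

lemma orbit_representatives:
  "\<exists>T. finite T \<and> T \<subseteq> X \<and> (\<forall>x\<in>X. \<exists>t\<in>T. \<exists>\<pi>\<in>fix_grp S A0. x = act \<pi> t)"
proof -
  obtain T where T: "finite T" "T \<subseteq> X" "orbit S act A0 ` X = orbit S act A0 ` T"
    using fin_orb finite_subset_image by (metis order_refl)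
  have "\<exists>t\<in>T. \<exists>\<pi>\<in>fix_grp S A0. x = act \<pi> t" if x: "x \<in> X" for x
  proof -
    obtain t where t: "t \<in> T" "orbit S act A0 x = orbit S act A0 t" using T(3) x by blast
    have "x \<in> orbit S act A0 x" by (rule orbit_self)
    then show ?thesis using t unfolding orbit_def by auto
  qed
  then show ?thesis using T by blast
qed

text \<open>Definability speaks of orbits over \<open>A0\<close> only, while later arguments enlarge
  the support. The orbit of \<open>act g t\<close> over \<open>C\<close> is determined by the orbit
  over \<open>C\<close> of the coding tuple \<open>map g (b t)\<close>.\<close>

lemma finite_orbits:
  assumes C: "finite C"
  shows "finite (orbit S act C ` X)"
proof -
  obtain T where T: "finite T" "T \<subseteq> X" "\<And>x. x \<in> X \<Longrightarrow> \<exists>t\<in>T. \<exists>\<pi>\<in>fix_grp S A0. x = act \<pi> t"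
    using orbit_representatives by blast
  obtain b where b: "\<And>t. \<forall>\<pi>\<in>fix_grp S (set (b t)). act \<pi> t = t" using ex_supp_list by metis
  \<comment> \<open>Decodes a set of tuples into the set of elements that these tuples code, for the
    representative \<open>t\<close>.\<close>
  define k where "k t w = {act \<pi> t | \<pi>. aut S \<pi> \<and> map \<pi> (b t) \<in> w}" for t w
  have k: "orbit S act C (act g t) = k t (orbit S map C (map g (b t)))" if g: "aut S g" for g t
  proof (intro set_eqI iffI)
    fix x assume "x \<in> orbit S act C (act g t)"
    then obtain h where h: "h \<in> fix_grp S C" "x = act h (act g t)" by (auto simp: orbit_def)
    then have "x = act (h \<circ> g) t" "aut S (h \<circ> g)" using g fix_grp_aut act_comp aut_comp by metis+
    then show "x \<in> k t (orbit S map C (map g (b t)))" unfolding k_def orbit_def using h(1) by fastforce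
  next
    fix x assume "x \<in> k t (orbit S map C (map g (b t)))"
    then obtain \<pi> h where h: "x = act \<pi> t" "aut S \<pi>" "h \<in> fix_grp S C" "map \<pi> (b t) = map h (map g (b t))"
      unfolding k_def orbit_def by blast
    then have "act \<pi> t = act (h \<circ> g) t"
      by (intro act_eq_if_map_eq[OF b]) (auto intro: aut_comp g fix_grp_aut)
    then have "x = act h (act g t)" using h g fix_grp_aut act_comp by metis
    then show "x \<in> orbit S act C (act g t)" using h(3) by (auto simp: orbit_def)
  qed
  have "orbit S act C ` X \<subseteq> (\<Union>t\<in>T. k t ` (orbit S map C ` {xs. length xs = length (b t)}))"
  proof
    fix w assume "w \<in> orbit S act C ` X"
    then obtain t g where t: "t \<in> T" "g \<in> fix_grp S A0" "w = orbit S act C (act g t)" using T(3) by force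
    then have "w = k t (orbit S map C (map g (b t)))" using k fix_grp_aut by blast
    moreover have "map g (b t) \<in> {xs. length xs = length (b t)}" by simp
    ultimately show "w \<in> (\<Union>t\<in>T. k t ` (orbit S map C ` {xs. length xs = length (b t)}))" using t(1) by blast
  qed
  moreover have "finite (\<Union>t\<in>T. k t ` (orbit S map C ` {xs. length xs = length (b t)}))"
    using T(1) finite_tuple_orbits[OF cnt cat C] by blast
  ultimately show ?thesis by (rule finite_subset)
qed

section \<open>The Boolean algebra of supported subsets\<close>

lemma fs_pow_subset: "U \<in> fs_pow S act X \<Longrightarrow> U \<subseteq> X"
  by (simp add: fs_pow_def)

lemma fs_powI: "U \<subseteq> X \<Longrightarrow> finite B \<Longrightarrow> supports_set S act B U \<Longrightarrow> U \<in> fs_pow S act X"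
  unfolding fs_pow_def by blast

lemma fs_powE:
  assumes "U \<in> fs_pow S act X"
  obtains B where "finite B" "A0 \<subseteq> B" "U \<subseteq> X" "supports_set S act B U"
proof -
  obtain B where "finite B" "supports_set S act B U" "U \<subseteq> X" using assms unfolding fs_pow_def by blast
  then show thesis using that[of "A0 \<union> B"] fin_A0 supports_set_mono[of B U "A0 \<union> B"] by simp
qed

lemma fs_pow_X [simp]: "X \<in> fs_pow S act X"
  using fs_powI fin_A0 supp_X by blast

lemma fs_pow_empty [simp]: "{} \<in> fs_pow S act X"
  by (rule fs_powI[of _ "{}"]) (auto intro: supports_setI)

lemma fs_pow_Int:
  assumes "U \<in> fs_pow S act X" "V \<in> fs_pow S act X"
  shows "U \<inter> V \<in> fs_pow S act X"
proof -
  obtain B C where "finite B" "U \<subseteq> X" "supports_set S act B U" "finite C" "supports_set S act C V"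
    using assms by (meson fs_powE)
  moreover then have "supports_set S act (B \<union> C) U" "supports_set S act (B \<union> C) V"
    by (auto elim: supports_set_mono)
  ultimately show ?thesis
    by (intro fs_powI[of _ "B \<union> C"] supports_setI) (auto simp: supports_set_mem)
qed

lemma fs_pow_Diff:
  assumes "U \<in> fs_pow S act X" "V \<in> fs_pow S act X"
  shows "U - V \<in> fs_pow S act X"
proof -
  obtain B C where "finite B" "U \<subseteq> X" "supports_set S act B U" "finite C" "supports_set S act C V"
    using assms by (meson fs_powE)
  moreover then have "supports_set S act (B \<union> C) U" "supports_set S act (B \<union> C) V"
    by (auto elim: supports_set_mono)
  ultimately show ?thesis
    by (intro fs_powI[of _ "B \<union> C"] supports_setI) (auto simp: supports_set_mem)
qed

lemma fs_pow_Un: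
  assumes "U \<in> fs_pow S act X" "V \<in> fs_pow S act X"
  shows "U \<union> V \<in> fs_pow S act X"
proof -
  have "U \<union> V = X - ((X - U) \<inter> (X - V))" using assms fs_pow_subset by blast
  then show ?thesis using assms fs_pow_Int fs_pow_Diff fs_pow_X by metis
qed

lemma fs_pow_UN: "finite F \<Longrightarrow> (\<And>i. i \<in> F \<Longrightarrow> f i \<in> fs_pow S act X) \<Longrightarrow> (\<Union>i\<in>F. f i) \<in> fs_pow S act X"
  by (induction F rule: finite_induct) (auto intro: fs_pow_Un)

lemma fs_pow_image:
  assumes "U \<in> fs_pow S act X" "\<pi> \<in> fix_grp S A0"
  shows "act \<pi> ` U \<in> fs_pow S act X"
proof -
  obtain B where "finite B" "U \<subseteq> X" "supports_set S act B U" using assms by (meson fs_powE)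
  moreover have "act \<pi> ` U \<subseteq> X" using supports_setD[OF supp_X assms(2)] calculation by blast
  ultimately show ?thesis using supports_set_image[OF _ fix_grp_aut[OF assms(2)]]
    by (intro fs_powI[of _ "\<pi> ` B"]) auto
qed

end

section \<open>Complete types and perfect trees\<close>

lemma extend_to_complete_type:
  fixes S :: "('a, 'f, 'r, 'z) fo_structure_scheme"
  assumes over: "\<And>\<phi>. \<phi> \<in> \<Sigma> \<Longrightarrow> fm_over S n B \<phi>"
    and fsat: "\<And>F. finite F \<Longrightarrow> F \<subseteq> \<Sigma> \<Longrightarrow> \<exists>v. \<forall>\<phi>\<in>F. sat S v \<phi>"
  shows "\<exists>p\<in>types S n B. \<Sigma> \<subseteq> p"
proof -
  \<comment> \<open>Finite satisfiability passes to unions of chains. A maximal set decides every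
    formula: if it omitted both a formula and its negation, finite parts contradicting each of them
    would together have no model.\<close>
  define \<A> where "\<A> = {p. \<Sigma> \<subseteq> p \<and> (\<forall>\<phi>\<in>p. fm_over S n B \<phi>) \<and> (\<forall>F. finite F \<and> F \<subseteq> p \<longrightarrow> (\<exists>v. \<forall>\<phi>\<in>F. sat S v \<phi>))}"
  have "\<Sigma> \<in> \<A>" unfolding \<A>_def using over fsat by blast
  moreover have "\<Union>\<C> \<in> \<A>" if ne: "\<C> \<noteq> {}" and ch: "subset.chain \<A> \<C>" for \<C>
  proof -
    have sub: "\<C> \<subseteq> \<A>" using ch by (simp add: subset.chain_def)
    have "\<exists>v. \<forall>\<phi>\<in>F. sat S v \<phi>" if F: "finite F" "F \<subseteq> \<Union>\<C>" for F
    proof -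
      obtain p where "p \<in> \<C>" "F \<subseteq> p" using finite_subset_Union_chain[OF F ne ch] by blast
      then show ?thesis using sub F(1) unfolding \<A>_def by blast
    qed
    moreover have "\<Sigma> \<subseteq> \<Union>\<C>" using ne sub unfolding \<A>_def by blast
    moreover have "\<forall>\<phi>\<in>\<Union>\<C>. fm_over S n B \<phi>" using sub unfolding \<A>_def by blast
    ultimately show ?thesis unfolding \<A>_def by simp
  qed
  ultimately obtain p where p: "p \<in> \<A>" and max: "\<And>q. q \<in> \<A> \<Longrightarrow> p \<subseteq> q \<Longrightarrow> q = p"
    using subset_Zorn_nonempty[of \<A>] by (metis empty_iff)
  have pf: "\<exists>v. \<forall>\<phi>\<in>F. sat S v \<phi>" if "finite F" "F \<subseteq> p" for F using p that unfolding \<A>_def by blast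
  have ext: "\<exists>F. finite F \<and> F \<subseteq> p \<and> (\<forall>v. (\<forall>\<phi>\<in>F. sat S v \<phi>) \<longrightarrow> \<not> sat S v \<phi>)"
    if phi: "fm_over S n B \<phi>" "\<phi> \<notin> p" for \<phi>
  proof (rule ccontr)
    assume neg: "\<not> ?thesis"
    have "\<exists>v. \<forall>\<phi>'\<in>F. sat S v \<phi>'" if "finite F" "F \<subseteq> insert \<phi> p" for F
    proof -
      have "finite (F - {\<phi>})" "F - {\<phi>} \<subseteq> p" using that by auto
      then obtain v where "\<forall>\<phi>'\<in>F - {\<phi>}. sat S v \<phi>'" "sat S v \<phi>" using neg by meson
      then show ?thesis by (intro exI[of _ v]) auto
    qed
    then have "insert \<phi> p \<in> \<A>" using p phi(1) unfolding \<A>_def by auto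
    then show False using max phi(2) by blast
  qed
  have "\<phi> \<in> p \<or> Neg \<phi> \<in> p" if phi: "fm_over S n B \<phi>" for \<phi>
  proof (rule ccontr)
    assume n: "\<not> (\<phi> \<in> p \<or> Neg \<phi> \<in> p)"
    have "fm_over S n B (Neg \<phi>)" using phi by (simp add: fm_over_def)
    then obtain F G where "finite F" "F \<subseteq> p" "\<forall>v. (\<forall>\<phi>\<in>F. sat S v \<phi>) \<longrightarrow> \<not> sat S v \<phi>"
        "finite G" "G \<subseteq> p" "\<forall>v. (\<forall>\<phi>\<in>G. sat S v \<phi>) \<longrightarrow> \<not> sat S v (Neg \<phi>)"
      using ext[OF phi] ext[of "Neg \<phi>"] n by meson
    then show False using pf[of "F \<union> G"] by auto
  qed
  then have "p \<in> types S n B" using p by (simp add: types_def complete_type_def \<A>_def)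
  then show ?thesis using p by (auto simp: \<A>_def)
qed

context definable_nominal
begin

text \<open>Branches of a perfect tree of definable sets give uncountably many types.\<close>

theorem no_perfect_tree:
  assumes sub: "\<B> \<subseteq> fs_pow S act X" and ne: "E0 \<in> \<B>" "{} \<notin> \<B>"
    and split: "\<And>E. E \<in> \<B> \<Longrightarrow> \<exists>E1\<in>\<B>. \<exists>E2\<in>\<B>. E1 \<subseteq> E \<and> E2 \<subseteq> E \<and> E1 \<inter> E2 = {}"
  shows False
proof -
  obtain T where T: "finite T" "T \<subseteq> X" "\<And>x. x \<in> X \<Longrightarrow> \<exists>t\<in>T. \<exists>\<pi>\<in>fix_grp S A0. x = act \<pi> t"
    using orbit_representatives by blast
  obtain b where b: "\<And>t. \<forall>\<pi>\<in>fix_grp S (set (b t)). act \<pi> t = t" using ex_supp_list by metis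
  \<comment> \<open>The tuples coding those elements of \<open>E\<close> that are translates of the
    representative \<open>t\<close>. A tuple determines its element, so disjoint sets have disjoint
    codes and a branching of the sets yields contradictory formulas.\<close>
  define Y where "Y t E = {map \<pi> (b t) | \<pi>. \<pi> \<in> fix_grp S A0 \<and> act \<pi> t \<in> E}" for t E
  have Ydisj: "Y t E1 \<inter> Y t E2 = {}" if disj: "E1 \<inter> E2 = {}" for t E1 E2
  proof (rule ccontr)
    assume "Y t E1 \<inter> Y t E2 \<noteq> {}"
    then obtain \<pi> \<sigma> where p: "\<pi> \<in> fix_grp S A0" "\<sigma> \<in> fix_grp S A0" "map \<pi> (b t) = map \<sigma> (b t)"
        "act \<pi> t \<in> E1" "act \<sigma> t \<in> E2" unfolding Y_def by blast
    then have "act \<pi> t = act \<sigma> t"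
      using act_eq_if_map_eq[OF b] fix_grp_aut by blast
    then show False using p(4,5) disj by auto
  qed
  have Ymono: "Y t E1 \<subseteq> Y t E2" if "E1 \<subseteq> E2" for t E1 E2
    using that unfolding Y_def by blast
  have Yne: "\<exists>t\<in>T. Y t E \<noteq> {}" if "E \<in> \<B>" for E
  proof -
    have "E \<noteq> {}" "E \<subseteq> X" using that ne sub fs_pow_subset by auto
    then obtain x where "x \<in> E" "x \<in> X" by blast
    then obtain t \<pi> where "t \<in> T" "\<pi> \<in> fix_grp S A0" "act \<pi> t \<in> E" using T(3) by metis
    then show ?thesis unfolding Y_def by blast
  qed
  have Ylen: "length w = length (b t)" if "w \<in> Y t E" for w t E using that unfolding Y_def by auto
  have "\<exists>\<phi>. fm_over S (length (b t)) UNIV \<phi> \<and> (\<forall>v. sat S v \<phi> \<longleftrightarrow> map v [0..<length (b t)] \<in> Y t E)"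
    if E: "E \<in> \<B>" for t E
  proof -
    obtain C where C: "finite C" "A0 \<subseteq> C" "supports_set S act C E" using fs_powE E sub by (metis subsetD)
    show ?thesis
    proof (rule supported_tuples_definable[OF cnt cat C(1)])
      fix \<pi> xs assume p: "\<pi> \<in> fix_grp S C" "xs \<in> Y t E"
      then obtain \<sigma> where s: "xs = map \<sigma> (b t)" "\<sigma> \<in> fix_grp S A0" "act \<sigma> t \<in> E" unfolding Y_def by blast
      have "\<pi> \<in> fix_grp S A0" using p C fix_grp_mono by blast
      then have "\<pi> \<circ> \<sigma> \<in> fix_grp S A0" "act (\<pi> \<circ> \<sigma>) t \<in> E"
        using s p C fix_grp_comp supports_set_mem[OF C(3)] act_comp fix_grp_aut by metis+
      moreover have "map \<pi> xs = map (\<pi> \<circ> \<sigma>) (b t)" by (simp add: s(1))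
      ultimately show "map \<pi> xs \<in> Y t E" unfolding Y_def by blast
    qed
  qed
  then have "\<forall>t E. \<exists>\<phi>. E \<in> \<B> \<longrightarrow> fm_over S (length (b t)) UNIV \<phi> \<and>
      (\<forall>v. sat S v \<phi> \<longleftrightarrow> map v [0..<length (b t)] \<in> Y t E)" by blast
  then obtain fo where "\<forall>t E. E \<in> \<B> \<longrightarrow> fm_over S (length (b t)) UNIV (fo t E) \<and>
      (\<forall>v. sat S v (fo t E) \<longleftrightarrow> map v [0..<length (b t)] \<in> Y t E)" unfolding choice_iff by blast
  then have fo: "\<And>t E. E \<in> \<B> \<Longrightarrow> fm_over S (length (b t)) UNIV (fo t E)"
      "\<And>t E v. E \<in> \<B> \<Longrightarrow> sat S v (fo t E) \<longleftrightarrow> map v [0..<length (b t)] \<in> Y t E" by simp_all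
  obtain L R where LR: "\<And>E. E \<in> \<B> \<Longrightarrow> L E \<in> \<B> \<and> R E \<in> \<B> \<and> L E \<subseteq> E \<and> R E \<subseteq> E \<and> L E \<inter> R E = {}"
    using split by metis
  \<comment> \<open>The branch of the binary tree described by the bit sequence
    \<open>\<eta>\<close>; distinct sequences reach disjoint sets one level after their first
    difference.\<close>
  define br where "br \<eta> = rec_nat E0 (\<lambda>n E. if \<eta> n then L E else R E)" for \<eta> :: "nat \<Rightarrow> bool"
  have br0: "br \<eta> 0 = E0" and brS: "br \<eta> (Suc n) = (if \<eta> n then L (br \<eta> n) else R (br \<eta> n))" for \<eta> n
    by (auto simp: br_def)
  have brB: "br \<eta> n \<in> \<B>" for \<eta> n by (induction n) (auto simp: br0 brS ne LR)
  have brmono: "br \<eta> n \<subseteq> br \<eta> m" if "m \<le> n" for \<eta> n m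
    by (rule lift_Suc_antimono_le[OF _ that]) (use LR brB in \<open>auto simp: brS\<close>)
  have brdiff: "\<exists>m. br \<eta> m \<inter> br \<theta> m = {}" if "\<eta> \<noteq> \<theta>" for \<eta> \<theta>
  proof -
    define m where "m = (LEAST m. \<eta> m \<noteq> \<theta> m)"
    have m: "\<eta> m \<noteq> \<theta> m" unfolding m_def by (rule LeastI_ex) (use that in auto)
    have e: "\<eta> k = \<theta> k" if "k < m" for k using not_less_Least that unfolding m_def by blast
    have "br \<eta> k = br \<theta> k" if "k \<le> m" for k
      using that by (induction k) (auto simp: br0 brS e)
    then have "br \<eta> m = br \<theta> m" by simp
    then have "br \<eta> (Suc m) \<inter> br \<theta> (Suc m) = {}" using m LR[OF brB[of \<theta> m]] by (auto simp: brS)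
    then show ?thesis by blast
  qed
  have "\<exists>t p. t \<in> T \<and> p \<in> types S (length (b t)) UNIV \<and> (\<forall>n. fo t (br \<eta> n) \<in> p)" for \<eta>
  proof -
    \<comment> \<open>One representative must serve the whole branch, since a type has a fixed
      number of variables. Codes shrink along the branch, so if each of the finitely many
      representatives died out, all would be dead at the largest of the levels \<open>N t\<close>,
      whose set is nonempty.\<close>
    have "\<exists>t\<in>T. \<forall>n. Y t (br \<eta> n) \<noteq> {}"
    proof (rule ccontr)
      assume "\<not> ?thesis"
      then have "\<forall>t\<in>T. \<exists>n. Y t (br \<eta> n) = {}" by blast
      then obtain N where N: "\<And>t. t \<in> T \<Longrightarrow> Y t (br \<eta> (N t)) = {}" unfolding bchoice_iff by blast
      define M where "M = Max (N ` T)"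
      have M: "N t \<le> M" if "t \<in> T" for t using T(1) that by (simp add: M_def)
      obtain t where "t \<in> T" "Y t (br \<eta> M) \<noteq> {}" using Yne brB by blast
      then show False using N[of t] Ymono[OF brmono[OF M], of t t \<eta>] by auto
    qed
    then obtain t where t: "t \<in> T" "\<And>n. Y t (br \<eta> n) \<noteq> {}" by blast
    have "\<exists>p\<in>types S (length (b t)) UNIV. range (\<lambda>n. fo t (br \<eta> n)) \<subseteq> p"
    proof (rule extend_to_complete_type)
      fix F assume F: "finite F" "F \<subseteq> range (\<lambda>n. fo t (br \<eta> n))"
      then obtain N where N: "finite N" "F = (\<lambda>n. fo t (br \<eta> n)) ` N" by (meson finite_subset_image)
      then obtain M where M: "\<And>n. n \<in> N \<Longrightarrow> n \<le> M" by (meson finite_nat_set_iff_bounded_le)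
      obtain w where w: "w \<in> Y t (br \<eta> M)" using t(2) by blast
      have e: "map (nth w) [0..<length (b t)] = w" using Ylen[OF w] by (metis map_nth)
      have "sat S (nth w) (fo t (br \<eta> n))" if "n \<in> N" for n
        using fo(2)[OF brB, of "nth w" t \<eta> n] e subsetD[OF Ymono[OF brmono[OF M[OF that]]] w] by simp
      then show "\<exists>v. \<forall>\<phi>\<in>F. sat S v \<phi>" using N by blast
    qed (use fo(1) brB in auto)
    then show ?thesis using t(1) by blast
  qed
  then have "\<forall>\<eta>. \<exists>t p. t \<in> T \<and> p \<in> types S (length (b t)) UNIV \<and> (\<forall>n. fo t (br \<eta> n) \<in> p)" by blast
  then obtain t p where "\<forall>\<eta>. t \<eta> \<in> T \<and> p \<eta> \<in> types S (length (b (t \<eta>))) UNIV \<and> (\<forall>n. fo (t \<eta>) (br \<eta> n) \<in> p \<eta>)"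
    unfolding choice_iff by blast
  then have tp: "\<And>\<eta>. t \<eta> \<in> T" "\<And>\<eta>. p \<eta> \<in> types S (length (b (t \<eta>))) UNIV" "\<And>\<eta> n. fo (t \<eta>) (br \<eta> n) \<in> p \<eta>"
    by simp_all
  have "inj (\<lambda>\<eta>. (t \<eta>, p \<eta>))"
  proof (rule injI, rule ccontr)
    fix \<eta> \<theta> assume eq: "(t \<eta>, p \<eta>) = (t \<theta>, p \<theta>)" and "\<eta> \<noteq> \<theta>"
    then obtain m where m: "br \<eta> m \<inter> br \<theta> m = {}" using brdiff by blast
    have "{fo (t \<eta>) (br \<eta> m), fo (t \<eta>) (br \<theta> m)} \<subseteq> p \<eta>" using tp(3)[of \<eta> m] tp(3)[of \<theta> m] eq by simp
    then obtain v where "\<forall>\<phi>\<in>{fo (t \<eta>) (br \<eta> m), fo (t \<eta>) (br \<theta> m)}. sat S v \<phi>"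
      using tp(2)[of \<eta>] unfolding types_def complete_type_def
      by (elim CollectE conjE allE[of _ "{fo (t \<eta>) (br \<eta> m), fo (t \<eta>) (br \<theta> m)}"]) auto
    then show False using fo(2)[OF brB] Ydisj[OF m, of "t \<eta>"] by auto
  qed
  moreover have "countable (range (\<lambda>\<eta>. (t \<eta>, p \<eta>)))"
  proof (rule countable_subset)
    show "range (\<lambda>\<eta>. (t \<eta>, p \<eta>)) \<subseteq> Sigma T (\<lambda>t. types S (length (b t)) UNIV)" using tp by auto
    show "countable (Sigma T (\<lambda>t. types S (length (b t)) UNIV))"
      using T(1) stable by (auto simp: omega_stable_def countable_finite)
  qed
  \<comment> \<open>The remaining contradiction is Cantor's diagonal argument.\<close>
  ultimately have "countable (UNIV :: (nat \<Rightarrow> bool) set)" by (rule countable_image_inj_on[rotated])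
  then obtain f :: "nat \<Rightarrow> nat \<Rightarrow> bool" where "range f = UNIV" by (metis UNIV_not_empty range_from_nat_into)
  then obtain i where "f i = (\<lambda>n. \<not> f n n)" by (metis surjD)
  then show False by (metis (full_types))
qed

end

section \<open>Half graphs\<close>

text \<open>The order property truncated at length \<open>n\<close>. The diagonal counts as related,
  so a half graph of length 1 already needs a related pair.\<close>

definition half_graph :: "('x \<Rightarrow> 'y \<Rightarrow> bool) \<Rightarrow> 'x set \<Rightarrow> 'y set \<Rightarrow> nat \<Rightarrow> bool" where
  "half_graph R X Y n \<longleftrightarrow> (\<exists>f g. (\<forall>i<n. f i \<in> X \<and> g i \<in> Y) \<and> (\<forall>i<n. \<forall>j<n. R (f i) (g j) \<longleftrightarrow> i \<le> j))"

lemma half_graphE: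
  assumes "half_graph R X Y n"
  obtains f g where "\<And>i. i < n \<Longrightarrow> f i \<in> X" "\<And>i. i < n \<Longrightarrow> g i \<in> Y"
    "\<And>i j. i < n \<Longrightarrow> j < n \<Longrightarrow> R (f i) (g j) \<longleftrightarrow> i \<le> j"
proof -
  obtain f g where "(\<forall>i<n. f i \<in> X \<and> g i \<in> Y) \<and> (\<forall>i<n. \<forall>j<n. R (f i) (g j) \<longleftrightarrow> i \<le> j)"
    using assms unfolding half_graph_def by (elim exE)
  then show thesis by (intro that[of f g]) simp_all
qed

lemma half_graphI:
  assumes "\<And>i. i < n \<Longrightarrow> f i \<in> X" "\<And>i. i < n \<Longrightarrow> g i \<in> Y"
    "\<And>i j. i < n \<Longrightarrow> j < n \<Longrightarrow> R (f i) (g j) \<longleftrightarrow> i \<le> j"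
  shows "half_graph R X Y n"
  unfolding half_graph_def using assms by (intro exI[of _ f] exI[of _ g]) simp

lemma half_graph_mono:
  assumes "half_graph R X Y n" "X \<subseteq> X'" "Y \<subseteq> Y'" "m \<le> n"
  shows "half_graph R X' Y' m"
proof -
  obtain f g where "\<forall>i<n. f i \<in> X \<and> g i \<in> Y" "\<forall>i<n. \<forall>j<n. R (f i) (g j) \<longleftrightarrow> i \<le> j"
    using assms(1) unfolding half_graph_def by blast
  then show ?thesis unfolding half_graph_def
    using assms(2-4) by (intro exI[of _ f] exI[of _ g]) auto
qed

lemma half_graph_converse:
  assumes "half_graph R X Y n"
  shows "half_graph (\<lambda>y x. R x y) Y X n"
proof -
  obtain f g where fg: "\<forall>i<n. f i \<in> X \<and> g i \<in> Y" "\<forall>i<n. \<forall>j<n. R (f i) (g j) \<longleftrightarrow> i \<le> j"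
    using assms unfolding half_graph_def by blast
  show ?thesis unfolding half_graph_def
  proof (intro exI conjI allI impI)
    fix i j assume "i < n" "j < n"
    \<comment> \<open>Exchanging the sides turns the order around; counting both sequences backwards
      restores it, diagonal included.\<close>
    then show "R (f (n - Suc j)) (g (n - Suc i)) \<longleftrightarrow> i \<le> j"
      using fg(2)[rule_format, of "n - Suc j" "n - Suc i"] by auto
  qed (use fg(1) in auto)
qed

text \<open>If no finite set hits, a half graph grows greedily: take a new \<open>x\<close> missed
  by all \<open>y\<close> chosen so far, then a \<open>y\<close> related to all \<open>x\<close>
  chosen so far, the new one included.\<close>

lemma finite_hitting_set:
  assumes nhg: "\<not> half_graph R X Y n"
    and common: "\<And>F. finite F \<Longrightarrow> F \<subseteq> X \<Longrightarrow> \<exists>y\<in>Y. \<forall>x\<in>F. R x y"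
  shows "\<exists>G. finite G \<and> G \<subseteq> Y \<and> (\<forall>x\<in>X. \<exists>y\<in>G. R x y)"
proof (rule ccontr)
  assume neg: "\<not> ?thesis"
  have "half_graph R X Y m" for m
  proof (induction m)
    case 0
    show ?case by (simp add: half_graph_def)
  next
    case (Suc m)
    then obtain f g where fg: "\<forall>i<m. f i \<in> X \<and> g i \<in> Y" "\<forall>i<m. \<forall>j<m. R (f i) (g j) \<longleftrightarrow> i \<le> j"
      unfolding half_graph_def by blast
    have "finite (g ` {..<m})" "g ` {..<m} \<subseteq> Y" using fg(1) by auto
    then obtain x where x: "x \<in> X" "\<forall>y\<in>g ` {..<m}. \<not> R x y" using neg by meson
    have "finite (insert x (f ` {..<m}))" "insert x (f ` {..<m}) \<subseteq> X" using fg(1) x(1) by auto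
    then obtain y where y: "y \<in> Y" "\<forall>x\<in>insert x (f ` {..<m}). R x y" using common by meson
    show ?case unfolding half_graph_def
      by (intro exI[of _ "f(m := x)"] exI[of _ "g(m := y)"])
        (use fg x y in \<open>auto simp: less_Suc_eq\<close>)
  qed
  then show False using nhg by blast
qed

text \<open>The sets admitting arbitrarily long half graphs would form a perfect tree: cutting along the
  middle vertex of a half graph leaves two long half graphs, and since there are finitely many orbits
  of vertices, a single cut works for all lengths.\<close>

theorem no_long_half_graphs:
  fixes S :: "('a, 'f, 'r) fo_structure" and act :: "('a \<Rightarrow> 'a) \<Rightarrow> 'x \<Rightarrow> 'x" and act' :: "('a \<Rightarrow> 'a) \<Rightarrow> 'y \<Rightarrow> 'y"
  assumes X: "definable_nominal S act A X" and Y: "definable_nominal S act' A' Y" and B: "finite B"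
    and R: "\<And>\<pi> x y. \<pi> \<in> fix_grp S B \<Longrightarrow> x \<in> X \<Longrightarrow> y \<in> Y \<Longrightarrow> R (act \<pi> x) (act' \<pi> y) \<longleftrightarrow> R x y"
  shows "\<exists>n. \<not> half_graph R X Y n"
proof (rule ccontr)
  assume "\<not> ?thesis"
  then have hg: "half_graph R X Y n" for n by blast
  interpret X: definable_nominal S act A X by (rule X)
  interpret Y: definable_nominal S act' A' Y by (rule Y)
  \<comment> \<open>Only the side of \<open>X\<close> is cut; the vertices in \<open>Y\<close> stay
    unrestricted.\<close>
  let ?\<B> = "{E \<in> fs_pow S act X. \<forall>n. half_graph R E Y n}"
  show False
  proof (rule X.no_perfect_tree[of ?\<B> X])
    show "X \<in> ?\<B>" using hg by auto
    have "\<not> half_graph R {} Y 1" by (auto simp: half_graph_def)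
    then show "{} \<notin> ?\<B>" by blast
  next
    fix E assume E: "E \<in> ?\<B>"
    then have "E \<in> fs_pow S act X" by simp
    then obtain C where C: "finite C" "E \<subseteq> X" "supports_set S act C E" by (rule X.fs_powE)
    \<comment> \<open>Fixing \<open>A'\<close> preserves \<open>Y\<close>, fixing \<open>B\<close>
      preserves the relation, and fixing \<open>C\<close> preserves \<open>E\<close>; hence
      \<open>Q n\<close> is invariant over \<open>D\<close>.\<close>
    define D where "D = A' \<union> B \<union> C"
    have D: "finite D" using B C(1) Y.fin_A0 by (simp add: D_def)
    define E1 where "E1 y = {x \<in> E. R x y}" for y
    define E2 where "E2 y = {x \<in> E. \<not> R x y}" for y
    define Q where "Q n y \<longleftrightarrow> half_graph R (E1 y) Y n \<and> half_graph R (E2 y) Y n" for n y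
    have "\<exists>y\<in>Y. Q n y" for n
    proof -
      \<comment> \<open>With \<open>2*n + 1\<close> vertices the middle one, \<open>g n\<close>, is
        related to \<open>f 0\<close>, ..., \<open>f n\<close> and unrelated to the last
        \<open>n\<close> vertices, so at least \<open>n\<close> remain on either side.\<close>
      have "half_graph R E Y (Suc (2*n))" using E by blast
      then obtain f g where fg: "\<And>i. i < Suc (2*n) \<Longrightarrow> f i \<in> E" "\<And>i. i < Suc (2*n) \<Longrightarrow> g i \<in> Y"
          "\<And>i j. i < Suc (2*n) \<Longrightarrow> j < Suc (2*n) \<Longrightarrow> R (f i) (g j) \<longleftrightarrow> i \<le> j"
        by (rule half_graphE) (rule that)
      have "half_graph R (E1 (g n)) Y n"
        by (rule half_graphI[of _ f _ g]) (use fg in \<open>simp_all add: E1_def\<close>)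
      moreover have "half_graph R (E2 (g n)) Y n"
        by (rule half_graphI[of _ "\<lambda>i. f (Suc (n + i))" _ "\<lambda>i. g (Suc (n + i))"])
          (use fg in \<open>simp_all add: E2_def\<close>)
      ultimately show ?thesis using fg(2)[of n] unfolding Q_def by auto
    qed
    then have "\<forall>n. \<exists>z. z \<in> Y \<and> Q n z" by blast
    then obtain y where "\<forall>n. y n \<in> Y \<and> Q n (y n)" unfolding choice_iff by (elim exE)
    then have y: "\<And>n. y n \<in> Y" "\<And>n. Q n (y n)" by simp_all
    have inv: "Q n (act' \<pi> z)" if "\<pi> \<in> fix_grp S D" "z \<in> Y" "Q n z" for \<pi> z n
    proof -
      have p: "\<pi> \<in> fix_grp S B" "\<pi> \<in> fix_grp S C" "\<pi> \<in> fix_grp S A'"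
        using that(1) fix_grp_mono[of _ D S] by (auto simp: D_def)
      have mem: "act \<pi> x \<in> E" if "x \<in> E" for x using that X.supports_set_mem[OF C(3) p(2)] by blast
      have memY: "act' \<pi> w \<in> Y" if "w \<in> Y" for w using that Y.supports_set_mem[OF Y.supp_X p(3)] by blast
      have move: "half_graph R F' Y n" if F: "half_graph R F Y n" "F \<subseteq> E" "\<And>x. x \<in> F \<Longrightarrow> act \<pi> x \<in> F'" for F F'
      proof -
        obtain f g where fg: "\<And>i. i < n \<Longrightarrow> f i \<in> F" "\<And>i. i < n \<Longrightarrow> g i \<in> Y"
            "\<And>i j. i < n \<Longrightarrow> j < n \<Longrightarrow> R (f i) (g j) \<longleftrightarrow> i \<le> j"
          using F(1) by (rule half_graphE) (rule that)
        have "R (act \<pi> (f i)) (act' \<pi> (g j)) \<longleftrightarrow> i \<le> j" if "i < n" "j < n" for i j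
          using R[OF p(1), of "f i" "g j"] fg(1,2,3) that F(2) C(2) by (simp add: subset_iff)
        then show ?thesis
          by (intro half_graphI[of _ "\<lambda>i. act \<pi> (f i)" _ "\<lambda>i. act' \<pi> (g i)"])
            (use fg(1,2) F(3) memY in simp_all)
      qed
      have "half_graph R (E1 (act' \<pi> z)) Y n"
        by (rule move[of "E1 z"]) (use that mem R[OF p(1)] C(2) in \<open>auto simp: Q_def E1_def subset_iff\<close>)
      moreover have "half_graph R (E2 (act' \<pi> z)) Y n"
        by (rule move[of "E2 z"]) (use that mem R[OF p(1)] C(2) in \<open>auto simp: Q_def E2_def subset_iff\<close>)
      ultimately show ?thesis by (simp add: Q_def)
    qed
    \<comment> \<open>The cutting vertex \<open>y n\<close> depends on the length. Infinitely many
      of these vertices lie in one orbit over \<open>D\<close>; by invariance a single vertex works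
      for unboundedly many lengths, and half graphs can be shortened.\<close>
    have "finite ((\<lambda>n. orbit S act' D (y n)) ` UNIV)"
      by (rule finite_subset[OF _ Y.finite_orbits[OF D]]) (use y in auto)
    then obtain k where k: "infinite {n \<in> UNIV. orbit S act' D (y n) = orbit S act' D (y k)}"
      using pigeonhole_infinite[of UNIV "\<lambda>n. orbit S act' D (y n)"] by auto
    have Qk: "Q m (y k)" for m
    proof -
      obtain n where n: "m \<le> n" "orbit S act' D (y n) = orbit S act' D (y k)"
        using k unfolding infinite_nat_iff_unbounded_le by blast
      have "y k \<in> orbit S act' D (y k)" by (rule Y.orbit_self)
      then obtain \<pi> where "\<pi> \<in> fix_grp S D" "y k = act' \<pi> (y n)" using n(2) by (auto simp: orbit_def)
      then have "Q n (y k)" using inv y by simp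
      then show ?thesis using n(1) half_graph_mono unfolding Q_def by blast
    qed
    obtain c where c: "\<forall>\<pi>\<in>fix_grp S (set c). act' \<pi> (y k) = y k" using Y.ex_supp_list by blast
    have Rk: "R (act \<pi> x) (y k) \<longleftrightarrow> R x (y k)" if "\<pi> \<in> fix_grp S (D \<union> set c)" "x \<in> E" for \<pi> x
    proof -
      have "\<pi> \<in> fix_grp S B" "\<pi> \<in> fix_grp S (set c)"
        using that(1) fix_grp_mono[of _ "D \<union> set c" S] by (auto simp: D_def)
      then show ?thesis using R[of \<pi> x "y k"] c that(2) C(2) y(1) by (metis subsetD)
    qed
    have memE: "act \<pi> x \<in> E" if "\<pi> \<in> fix_grp S (D \<union> set c)" "x \<in> E" for \<pi> x
      using that fix_grp_mono[of C "D \<union> set c" S] X.supports_set_mem[OF C(3)] by (auto simp: D_def)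
    have "E1 (y k) \<in> fs_pow S act X" "E2 (y k) \<in> fs_pow S act X"
      by (rule X.fs_powI[of _ "D \<union> set c"], use C(2) D memE Rk in \<open>auto simp: E1_def E2_def intro!: X.supports_setI\<close>)+
    then show "\<exists>F\<in>?\<B>. \<exists>G\<in>?\<B>. F \<subseteq> E \<and> G \<subseteq> E \<and> F \<inter> G = {}"
      using Qk by (intro bexI[of _ "E1 (y k)"] bexI[of _ "E2 (y k)"]) (auto simp: Q_def E1_def E2_def)
  qed auto
qed

section \<open>Ideals and ultrafilters of supported sets\<close>

definition ideal_on :: "'x set set \<Rightarrow> 'x set set \<Rightarrow> bool" where
  "ideal_on P I \<longleftrightarrow> I \<subseteq> P \<and> {} \<in> I \<and> (\<forall>U\<in>I. \<forall>V\<in>I. U \<union> V \<in> I) \<and> (\<forall>U\<in>I. \<forall>V\<in>P. V \<subseteq> U \<longrightarrow> V \<in> I)"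

lemma ideal_onD:
  assumes "ideal_on P I"
  shows "I \<subseteq> P" "{} \<in> I" "U \<in> I \<Longrightarrow> V \<in> I \<Longrightarrow> U \<union> V \<in> I" "U \<in> I \<Longrightarrow> V \<in> P \<Longrightarrow> V \<subseteq> U \<Longrightarrow> V \<in> I"
  using assms unfolding ideal_on_def by simp_all

lemma ideal_on_UN: "finite F \<Longrightarrow> ideal_on P I \<Longrightarrow> (\<And>i. i \<in> F \<Longrightarrow> f i \<in> I) \<Longrightarrow> (\<Union>i\<in>F. f i) \<in> I"
  by (induction F rule: finite_induct) (auto intro: ideal_onD)

lemma ultrafilter_onD:
  assumes "ultrafilter_on P X \<U>"
  shows "\<U> \<subseteq> P" "X \<in> \<U>" "{} \<notin> \<U>" "U \<in> \<U> \<Longrightarrow> V \<in> \<U> \<Longrightarrow> U \<inter> V \<in> \<U>"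
    "U \<in> \<U> \<Longrightarrow> V \<in> P \<Longrightarrow> U \<subseteq> V \<Longrightarrow> V \<in> \<U>" "U \<in> P \<Longrightarrow> U \<in> \<U> \<or> X - U \<in> \<U>"
  using assms unfolding ultrafilter_on_def by simp_all

context definable_nominal
begin

abbreviation P where "P \<equiv> fs_pow S act X"

lemma ultrafilter_UN:
  assumes "ultrafilter_on P X \<U>" "finite F" "\<And>i. i \<in> F \<Longrightarrow> f i \<in> P" "(\<Union>i\<in>F. f i) \<in> \<U>"
  shows "\<exists>i\<in>F. f i \<in> \<U>"
  using assms(2-4)
proof (induction F rule: finite_induct)
  case empty
  then show ?case using ultrafilter_onD(3)[OF assms(1)] by simp
next
  case (insert i F)
  show ?case
  proof (cases "f i \<in> \<U>")
    case False
    then have "X - f i \<in> \<U>" using insert.prems(1) ultrafilter_onD(6)[OF assms(1)] by blast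
    then have "(\<Union>i\<in>insert i F. f i) \<inter> (X - f i) \<in> \<U>" using insert.prems(2) ultrafilter_onD(4)[OF assms(1)] by blast
    moreover have "(\<Union>i\<in>F. f i) \<in> P" using insert.hyps insert.prems by (intro fs_pow_UN) auto
    ultimately have "(\<Union>i\<in>F. f i) \<in> \<U>" using ultrafilter_onD(5)[OF assms(1)] by blast
    then show ?thesis using insert by auto
  qed auto
qed

lemma ultrafilter_Diff:
  assumes "ultrafilter_on P X \<U>" "U \<in> \<U>" "V \<in> P" "V \<notin> \<U>"
  shows "U - V \<in> \<U>"
proof -
  have "X - V \<in> \<U>" using assms ultrafilter_onD(6) by blast
  then have "U \<inter> (X - V) \<in> \<U>" using assms ultrafilter_onD(4) by blast
  moreover have "U \<inter> (X - V) = U - V" using ultrafilter_onD(1)[OF assms(1)] assms(2) fs_pow_subset by blast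
  ultimately show ?thesis by simp
qed

text \<open>Without such a \<open>Z\<close>, the supported subsets of \<open>D\<close> outside the
  ideal could be split forever, against \<open>no_perfect_tree\<close>.\<close>

lemma ex_atom_modulo_ideal:
  assumes I: "ideal_on P I" and D: "D \<in> P" "D \<notin> I"
  shows "\<exists>Z\<in>P. Z \<subseteq> D \<and> Z \<notin> I \<and> (\<forall>V\<in>P. Z \<inter> V \<in> I \<or> Z - V \<in> I)"
proof (rule ccontr)
  assume neg: "\<not> ?thesis"
  let ?\<B> = "{E \<in> P. E \<subseteq> D \<and> E \<notin> I}"
  show False
  proof (rule no_perfect_tree[of ?\<B> D])
    fix E assume "E \<in> ?\<B>"
    then obtain V where "V \<in> P" "E \<inter> V \<notin> I" "E - V \<notin> I" using neg by auto
    then show "\<exists>E1\<in>?\<B>. \<exists>E2\<in>?\<B>. E1 \<subseteq> E \<and> E2 \<subseteq> E \<and> E1 \<inter> E2 = {}"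
      using \<open>E \<in> ?\<B>\<close> fs_pow_Int fs_pow_Diff
      by (intro bexI[of _ "E \<inter> V"] bexI[of _ "E - V"]) auto
  qed (use D ideal_onD(2)[OF I] in auto)
qed

lemma act_uf_mem_iff: "aut S \<pi> \<Longrightarrow> E \<in> act_uf act \<pi> \<U> \<longleftrightarrow> act (inv \<pi>) ` E \<in> \<U>"
  unfolding act_uf_def act_set_def by (metis (no_types, lifting) image_act_inv image_iff)

lemma act_uf_eqI:
  assumes "\<And>\<pi> E. \<pi> \<in> fix_grp S B \<Longrightarrow> E \<in> \<U> \<Longrightarrow> act \<pi> ` E \<in> \<U>" "\<pi> \<in> fix_grp S B"
  shows "act_uf act \<pi> \<U> = \<U>"
proof -
  have a: "aut S \<pi>" using assms(2) fix_grp_aut by blast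
  have "act (inv \<pi>) ` E \<in> \<U> \<longleftrightarrow> E \<in> \<U>" for E
    using assms(1)[OF assms(2), of "act (inv \<pi>) ` E"] assms(1)[OF fix_grp_inv[OF assms(2)], of E] a by auto
  then show ?thesis using act_uf_mem_iff[OF a] by blast
qed

text \<open>An atom \<open>Z\<close> modulo \<open>I\<close> decides every supported set: take those
  whose intersection with \<open>Z\<close> is not in \<open>I\<close>. This ultrafilter is supported
  by \<open>B\<close> together with a support of \<open>Z\<close>, which an ultrafilter obtained
  from Zorn's lemma could not guarantee.\<close>

lemma ex_ultrafilter_avoiding_ideal:
  assumes I: "ideal_on P I" and B: "finite B"
    and inv: "\<And>\<pi> U. \<pi> \<in> fix_grp S B \<Longrightarrow> U \<in> I \<Longrightarrow> act \<pi> ` U \<in> I"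
    and D: "D \<in> P" "D \<notin> I"
  shows "\<exists>\<U>\<in>stone_cech S act X. D \<in> \<U> \<and> \<U> \<inter> I = {}"
proof -
  note Id = ideal_onD[OF I]
  obtain Z where Z: "Z \<in> P" "Z \<subseteq> D" "Z \<notin> I" "\<And>V. V \<in> P \<Longrightarrow> Z \<inter> V \<in> I \<or> Z - V \<in> I"
    using ex_atom_modulo_ideal[OF I D] by blast
  obtain C where C: "finite C" "A0 \<subseteq> C" "supports_set S act C Z" by (rule fs_powE[OF Z(1)])
  define \<U> where "\<U> = {E \<in> P. Z \<inter> E \<notin> I}"
  have Zm: "\<not> (Z - V \<in> I \<and> Z \<inter> V \<in> I)" for V using Id(3)[of "Z - V" "Z \<inter> V"] Z(3) by (metis Un_Diff_Int)
  have "ultrafilter_on P X \<U>"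
    unfolding ultrafilter_on_def
  proof (intro conjI ballI impI)
    have "Z \<inter> X = Z" using Z(1) fs_pow_subset by blast
    then show "X \<in> \<U>" using Z(3) by (simp add: \<U>_def)
    show "U \<inter> V \<in> \<U>" if "U \<in> \<U>" "V \<in> \<U>" for U V
    proof -
      have UV: "U \<in> P" "V \<in> P" using that by (auto simp: \<U>_def)
      have "Z - U \<in> I" "Z - V \<in> I" using that Z(4) by (auto simp: \<U>_def)
      then have "Z - U \<inter> V \<in> I" using Id(3) by (metis Diff_Int)
      then show ?thesis using Zm UV fs_pow_Int by (auto simp: \<U>_def)
    qed
    show "V \<in> \<U>" if "U \<in> \<U>" "V \<in> P" "U \<subseteq> V" for U V
      using that Id(4)[of "Z \<inter> V" "Z \<inter> U"] fs_pow_Int[OF Z(1), of U] by (auto simp: \<U>_def)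
    show "U \<in> \<U> \<or> X - U \<in> \<U>" if "U \<in> P" for U
    proof -
      have "Z \<inter> (X - U) = Z - U" using Z(1) fs_pow_subset by blast
      then show ?thesis using Zm that fs_pow_Diff by (auto simp: \<U>_def)
    qed
  qed (use Id(2) in \<open>auto simp: \<U>_def\<close>)
  moreover have "\<exists>B. finite B \<and> (\<forall>\<pi>\<in>fix_grp S B. act_uf act \<pi> \<U> = \<U>)"
  proof (intro exI conjI ballI)
    show "finite (B \<union> C)" using B C by simp
    fix \<pi> assume "\<pi> \<in> fix_grp S (B \<union> C)"
    then show "act_uf act \<pi> \<U> = \<U>"
    proof (rule act_uf_eqI[rotated])
      fix \<sigma> E assume s: "\<sigma> \<in> fix_grp S (B \<union> C)" and E: "E \<in> \<U>"
      then have sB: "\<sigma> \<in> fix_grp S B" and sC: "\<sigma> \<in> fix_grp S C" and sA: "\<sigma> \<in> fix_grp S A0"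
        using C(2) fix_grp_mono[of _ "B \<union> C" S] by blast+
      have a: "aut S \<sigma>" using s fix_grp_aut by blast
      have "act \<sigma> ` (Z \<inter> E) = Z \<inter> act \<sigma> ` E"
        using supports_setD[OF C(3) sC] image_Int[OF inj_act[OF a]] by simp
      then have "Z \<inter> E \<in> I" if "Z \<inter> act \<sigma> ` E \<in> I"
        using inv[OF fix_grp_inv[OF sB] that] a by (metis image_act_inv(1))
      then show "act \<sigma> ` E \<in> \<U>" using E fs_pow_image[OF _ sA] by (auto simp: \<U>_def)
    qed
  qed
  moreover have "D \<in> \<U>" using D(1) Z(2,3) by (simp add: \<U>_def Int_absorb2)
  moreover have "\<U> \<inter> I = {}"
  proof -
    have "E \<notin> I" if "E \<in> \<U>" for E
      using that Id(4)[of E "Z \<inter> E"] fs_pow_Int[OF Z(1), of E] by (auto simp: \<U>_def)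
    then show ?thesis by blast
  qed
  ultimately show ?thesis by (intro bexI[of _ \<U>]) (auto simp: stone_cech_def)
qed

end

section \<open>Translates of a set in an invariant ultrafilter\<close>

text \<open>Openness is meant in the topology of pointwise convergence. Stabilizers of ultrafilters
  have this form without being given by a finite set of atoms.\<close>

definition open_subgroup :: "('a, 'f, 'r, 'z) fo_structure_scheme \<Rightarrow> ('a \<Rightarrow> 'a) set \<Rightarrow> bool" where
  "open_subgroup S \<Gamma> \<longleftrightarrow> (\<forall>\<pi>\<in>\<Gamma>. aut S \<pi>) \<and> (\<forall>\<pi>\<in>\<Gamma>. \<forall>\<sigma>\<in>\<Gamma>. \<pi> \<circ> \<sigma> \<in> \<Gamma>) \<and> (\<forall>\<pi>\<in>\<Gamma>. inv \<pi> \<in> \<Gamma>) \<and>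
     (\<exists>B. finite B \<and> fix_grp S B \<subseteq> \<Gamma>)"

lemma open_subgroupD:
  assumes "open_subgroup S \<Gamma>"
  shows "\<pi> \<in> \<Gamma> \<Longrightarrow> aut S \<pi>" "\<pi> \<in> \<Gamma> \<Longrightarrow> \<sigma> \<in> \<Gamma> \<Longrightarrow> \<pi> \<circ> \<sigma> \<in> \<Gamma>" "\<pi> \<in> \<Gamma> \<Longrightarrow> inv \<pi> \<in> \<Gamma>" "id \<in> \<Gamma>"
proof -
  show "\<pi> \<in> \<Gamma> \<Longrightarrow> aut S \<pi>" "\<pi> \<in> \<Gamma> \<Longrightarrow> \<sigma> \<in> \<Gamma> \<Longrightarrow> \<pi> \<circ> \<sigma> \<in> \<Gamma>" "\<pi> \<in> \<Gamma> \<Longrightarrow> inv \<pi> \<in> \<Gamma>"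
    using assms by (simp_all add: open_subgroup_def)
  have "id \<in> fix_grp S B" for B by (simp add: fix_grp_def aut_id)
  then show "id \<in> \<Gamma>" using assms unfolding open_subgroup_def by blast
qed

context nominal
begin

text \<open>The analogue of \<open>act_eq_if_map_eq\<close> for sets: the translates of a supported
  set are coded by the images of a support list.\<close>

lemma image_act_eq_if_map_eq:
  assumes "supports_set S act (set b) E" "aut S \<pi>" "aut S \<sigma>" "map \<pi> b = map \<sigma> b"
  shows "act \<pi> ` E = act \<sigma> ` E"
proof -
  have "map (inv \<sigma> \<circ> \<pi>) b = map (inv \<sigma> \<circ> \<sigma>) b" using assms(4) by (metis map_map)
  then have "inv \<sigma> \<circ> \<pi> \<in> fix_grp S (set b)"
    using assms(2,3) aut_comp aut_inv aut_inv_comp(1) fix_grp_set[of "inv \<sigma> \<circ> \<pi>" S b] by (metis list.map_id)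
  then have "act (inv \<sigma> \<circ> \<pi>) ` E = E" using supports_setD[OF assms(1)] by blast
  then have "act (inv \<sigma>) ` act \<pi> ` E = E" using image_act_comp[OF aut_inv[OF assms(3)] assms(2)] by simp
  then show ?thesis using assms(3) by (metis image_act_inv(2))
qed

text \<open>A maximal invariant proper ideal I of supported sets has a finite quotient, namely the one
  generated by the translates of a single atom.\<close>

lemma ex_cofinite_invariant_ideal:
  assumes W: "definable_nominal S act B W" "W \<noteq> {}"
    and \<Gamma>: "open_subgroup S \<Gamma>" and inv: "\<forall>g\<in>\<Gamma>. \<forall>w\<in>W. act g w \<in> W"
  shows "\<exists>I Z G. ideal_on (fs_pow S act W) I \<and> (\<forall>g\<in>\<Gamma>. \<forall>U\<in>I. act g ` U \<in> I) \<and> W \<notin> I \<and>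
    Z \<in> fs_pow S act W \<and> Z \<notin> I \<and> (\<forall>V\<in>fs_pow S act W. Z \<inter> V \<in> I \<or> Z - V \<in> I) \<and>
    finite G \<and> G \<subseteq> \<Gamma> \<and> W - (\<Union>g\<in>G. act g ` Z) \<in> I"
proof -
  interpret W: definable_nominal S act B W by (rule W(1))
  note G = open_subgroupD[OF \<Gamma>]
  let ?P = "fs_pow S act W"
  have Pim: "act g ` U \<in> ?P" if gU: "g \<in> \<Gamma>" "U \<in> ?P" for g U
  proof -
    obtain C where C: "finite C" "B \<subseteq> C" "U \<subseteq> W" "supports_set S act C U" by (rule W.fs_powE[OF gU(2)])
    show ?thesis
      by (rule W.fs_powI[of _ "g ` C"]) (use C inv gU(1) supports_set_image[OF C(4) G(1)] in auto)
  qed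
  define \<A> where "\<A> = {I. ideal_on ?P I \<and> (\<forall>g\<in>\<Gamma>. \<forall>U\<in>I. act g ` U \<in> I) \<and> W \<notin> I}"
  have "{{}} \<in> \<A>" using W(2) by (auto simp: \<A>_def ideal_on_def)
  moreover have "\<Union>\<C> \<in> \<A>" if ne: "\<C> \<noteq> {}" and ch: "subset.chain \<A> \<C>" for \<C>
  proof -
    have sub: "\<C> \<subseteq> \<A>" using ch by (simp add: subset.chain_def)
    have id: "ideal_on ?P I" if "I \<in> \<C>" for I using sub that by (auto simp: \<A>_def)
    have "U \<union> V \<in> \<Union>\<C>" if UV: "U \<in> \<Union>\<C>" "V \<in> \<Union>\<C>" for U V
    proof -
      have "finite {U, V}" "{U, V} \<subseteq> \<Union>\<C>" using UV by auto
      then obtain I where "I \<in> \<C>" "{U, V} \<subseteq> I" by (rule finite_subset_Union_chain[OF _ _ ne ch])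
      then have "U \<union> V \<in> I" using ideal_onD(3)[OF id, of I U V] by simp
      then show ?thesis using \<open>I \<in> \<C>\<close> by blast
    qed
    moreover have "\<Union>\<C> \<subseteq> ?P" using ideal_onD(1)[OF id] by blast
    moreover have "{} \<in> \<Union>\<C>" using ideal_onD(2)[OF id] ne by blast
    moreover have "V \<in> \<Union>\<C>" if U: "U \<in> \<Union>\<C>" "V \<in> ?P" "V \<subseteq> U" for U V
    proof -
      obtain I where "I \<in> \<C>" "U \<in> I" using U(1) by blast
      then have "V \<in> I" using ideal_onD(4)[OF id, of I U V] U(2,3) by simp
      then show ?thesis using \<open>I \<in> \<C>\<close> by blast
    qed
    ultimately have "ideal_on ?P (\<Union>\<C>)" unfolding ideal_on_def by (intro conjI ballI impI)
    moreover have "\<forall>g\<in>\<Gamma>. \<forall>U\<in>\<Union>\<C>. act g ` U \<in> \<Union>\<C>" using sub by (auto simp: \<A>_def subset_iff)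
    moreover have "W \<notin> \<Union>\<C>" using sub by (auto simp: \<A>_def)
    ultimately show ?thesis by (simp add: \<A>_def)
  qed
  ultimately obtain I where I: "I \<in> \<A>" and max: "\<And>J. J \<in> \<A> \<Longrightarrow> I \<subseteq> J \<Longrightarrow> J = I"
    using subset_Zorn_nonempty[of \<A>] by (metis empty_iff)
  have Iid: "ideal_on ?P I" and Iinv: "\<And>g U. g \<in> \<Gamma> \<Longrightarrow> U \<in> I \<Longrightarrow> act g ` U \<in> I" and WI: "W \<notin> I"
    using I by (auto simp: \<A>_def)
  note Id = ideal_onD[OF Iid]
  obtain Z where Z: "Z \<in> ?P" "Z \<notin> I" "\<forall>V\<in>?P. Z \<inter> V \<in> I \<or> Z - V \<in> I"
    using W.ex_atom_modulo_ideal[OF Iid W.fs_pow_X WI] by blast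
  \<comment> \<open>The invariant ideal generated by \<open>I\<close> and \<open>Z\<close>. It
    properly extends \<open>I\<close>, so by maximality it contains \<open>W\<close>, which says
    that finitely many translates of \<open>Z\<close> cover \<open>W\<close> up to a member of
    \<open>I\<close>.\<close>
  define J where "J = {T \<in> ?P. \<exists>i\<in>I. \<exists>G. finite G \<and> G \<subseteq> \<Gamma> \<and> T \<subseteq> i \<union> (\<Union>g\<in>G. act g ` Z)}"
  have JI: "T \<in> J" if "T \<in> ?P" "i \<in> I" "finite G" "G \<subseteq> \<Gamma>" "T \<subseteq> i \<union> (\<Union>g\<in>G. act g ` Z)" for T i G
    unfolding J_def using that by blast
  have JE: "\<exists>i G. T \<in> ?P \<and> i \<in> I \<and> finite G \<and> G \<subseteq> \<Gamma> \<and> T \<subseteq> i \<union> (\<Union>g\<in>G. act g ` Z)" if "T \<in> J" for T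
    using that unfolding J_def by blast
  have "I \<subseteq> J"
  proof
    fix T assume "T \<in> I"
    then show "T \<in> J" using JI[of T T "{}"] Id(1) by auto
  qed
  moreover have "Z \<in> J" using JI[of Z "{}" "{id}"] Z(1) Id(2) G(4) by simp
  ultimately have "J \<notin> \<A>" using max Z(2) by blast
  moreover have "ideal_on ?P J"
    unfolding ideal_on_def
  proof (intro conjI ballI impI)
    show "J \<subseteq> ?P" by (auto simp: J_def)
    show "{} \<in> J" using \<open>I \<subseteq> J\<close> Id(2) by blast
    show "T \<in> J" if U: "U \<in> J" "T \<in> ?P" "T \<subseteq> U" for U T
    proof -
      obtain i G where "i \<in> I" "finite G" "G \<subseteq> \<Gamma>" "U \<subseteq> i \<union> (\<Union>g\<in>G. act g ` Z)" using JE[OF U(1)] by blast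
      then show ?thesis using JI[OF U(2), of i G] U(3) by blast
    qed
    show "U \<union> V \<in> J" if UV: "U \<in> J" "V \<in> J" for U V
    proof -
      obtain i G where "U \<in> ?P" "i \<in> I" "finite G" "G \<subseteq> \<Gamma>" "U \<subseteq> i \<union> (\<Union>g\<in>G. act g ` Z)" using JE[OF UV(1)] by blast
      moreover obtain j H where "V \<in> ?P" "j \<in> I" "finite H" "H \<subseteq> \<Gamma>" "V \<subseteq> j \<union> (\<Union>g\<in>H. act g ` Z)" using JE[OF UV(2)] by blast
      ultimately show ?thesis using Id(3) W.fs_pow_Un by (intro JI[of _ "i \<union> j" "G \<union> H"]) auto
    qed
  qed
  moreover have "act h ` T \<in> J" if h: "h \<in> \<Gamma>" and T: "T \<in> J" for h T
  proof -
    obtain i G' where i: "T \<in> ?P" "i \<in> I" "finite G'" "G' \<subseteq> \<Gamma>" "T \<subseteq> i \<union> (\<Union>g\<in>G'. act g ` Z)" using JE[OF T] by blast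
    have "act h ` T \<subseteq> act h ` (i \<union> (\<Union>g\<in>G'. act g ` Z))" using i(5) by (rule image_mono)
    also have "\<dots> = act h ` i \<union> (\<Union>g\<in>G'. act h ` act g ` Z)" by (simp only: image_Un image_UN)
    also have "(\<Union>g\<in>G'. act h ` act g ` Z) = (\<Union>g\<in>(\<lambda>g. h \<circ> g) ` G'. act g ` Z)"
      using i(4) image_act_comp[OF G(1)[OF h] G(1)] by (simp add: subset_iff)
    finally show ?thesis using i h G(2) Pim Iinv by (intro JI[of _ "act h ` i" "(\<lambda>g. h \<circ> g) ` G'"]) auto
  qed
  ultimately have "W \<in> J" by (auto simp: \<A>_def)
  then obtain i G' where i: "i \<in> I" "finite G'" "G' \<subseteq> \<Gamma>" "W \<subseteq> i \<union> (\<Union>g\<in>G'. act g ` Z)" using JE by blast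
  have "(\<Union>g\<in>G'. act g ` Z) \<in> ?P" using i Pim Z(1) by (intro W.fs_pow_UN) auto
  then have "W - (\<Union>g\<in>G'. act g ` Z) \<in> ?P" by (rule W.fs_pow_Diff[OF W.fs_pow_X])
  moreover have "W - (\<Union>g\<in>G'. act g ` Z) \<subseteq> i" using i(4) by (simp add: Diff_subset_conv Un_commute)
  ultimately have "W - (\<Union>g\<in>G'. act g ` Z) \<in> I" using Id(4)[OF i(1)] by simp
  then show ?thesis using Iid Iinv WI Z i(2,3) by (intro exI[of _ I] exI[of _ Z] exI[of _ G'] conjI ballI) simp_all
qed

end

context definable_nominal
begin

text \<open>The nonforking argument: no half graphs between points and translates of E lets finitely many
  points meet all translates, and then finitely many translates contain all points.\<close>

theorem finitely_many_translates_cover: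
  assumes \<Gamma>: "open_subgroup S \<Gamma>"
    and \<U>: "ultrafilter_on P X \<U>" and inv: "\<And>g U. g \<in> \<Gamma> \<Longrightarrow> U \<in> \<U> \<Longrightarrow> act g ` U \<in> \<U>"
    and Q0: "Q0 = {act g x0 | g. g \<in> \<Gamma>}" "Q0 \<in> \<U>" and E: "E \<in> \<U>"
  shows "\<exists>T. finite T \<and> T \<subseteq> \<Gamma> \<and> Q0 \<subseteq> (\<Union>g\<in>T. act g ` E)"
proof -
  note G = open_subgroupD[OF \<Gamma>] and UF = ultrafilter_onD[OF \<U>]
  obtain B where B: "finite B" "fix_grp S B \<subseteq> \<Gamma>" using \<Gamma> unfolding open_subgroup_def by blast
  have OX: "Q0 \<subseteq> X" using Q0(2) UF(1) fs_pow_subset by blast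
  have "E \<in> P" using E UF(1) by blast
  then obtain C where C: "finite C" "supports_set S act C E" by (rule fs_powE)
  obtain b where b: "set b = C" using C(1) finite_list by blast
  note suppE = C(2)[folded b]
  \<comment> \<open>Tuples coding the translates of \<open>E\<close>. As \<open>b\<close> supports
    \<open>E\<close>, membership of a point in a translate becomes the relation \<open>R\<close>
    between points and tuples.\<close>
  define W where "W = {map g b | g. g \<in> \<Gamma>}"
  define R where "R x w \<longleftrightarrow> (\<exists>g\<in>\<Gamma>. w = map g b \<and> x \<in> act g ` E)" for x w
  have Rg: "R x (map g b) \<longleftrightarrow> x \<in> act g ` E" if "g \<in> \<Gamma>" for g x
    unfolding R_def using image_act_eq_if_map_eq[OF suppE] G(1) that by metis
  have Winv: "map h w \<in> W" if hw: "h \<in> \<Gamma>" "w \<in> W" for h w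
  proof -
    obtain g where "g \<in> \<Gamma>" "w = map g b" using hw(2) by (auto simp: W_def)
    then have "h \<circ> g \<in> \<Gamma>" "map h w = map (h \<circ> g) b" using hw(1) G(2) by auto
    then show ?thesis unfolding W_def by blast
  qed
  have Oinv: "act h x \<in> Q0" if hx: "h \<in> \<Gamma>" "x \<in> Q0" for h x
  proof -
    obtain g where "g \<in> \<Gamma>" "x = act g x0" using hx(2) Q0(1) by blast
    then have "h \<circ> g \<in> \<Gamma>" "act h x = act (h \<circ> g) x0" using hx(1) G(1,2) act_comp by auto
    then show ?thesis unfolding Q0(1) by blast
  qed
  have Requiv: "R (act h x) (map h w) \<longleftrightarrow> R x w" if h: "h \<in> \<Gamma>" and w: "w \<in> W" for h x w
  proof -
    obtain g where g: "g \<in> \<Gamma>" "w = map g b" using w by (auto simp: W_def)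
    have "R (act h x) (map h w) \<longleftrightarrow> act h x \<in> act (h \<circ> g) ` E" using Rg[OF G(2)[OF h g(1)]] g(2) by simp
    also have "\<dots> \<longleftrightarrow> x \<in> act g ` E"
      using image_act_comp[OF G(1)[OF h] G(1)[OF g(1)]] inj_image_mem_iff[OF inj_act[OF G(1)[OF h]]] by simp
    finally show ?thesis using Rg[OF g(1)] g(2) by simp
  qed
  interpret N: nominal S map by (rule nominal_map)
  have W: "definable_nominal S map B W"
  proof
    show "supports_set S map B W" by (rule N.supports_setI) (use Winv B(2) in blast)
    have "W \<subseteq> {xs. length xs = length b}" by (auto simp: W_def)
    then show "finite (orbit S map B ` W)"
      using finite_tuple_orbits[OF cnt cat B(1), of "length b"] by (meson finite_subset image_mono)
  qed (use cnt cat stable B in auto)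
  interpret W: definable_nominal S map B W by (rule W)
  let ?Q = "fs_pow S map W"
  have "\<exists>n. \<not> half_graph R X W n"
    by (rule no_long_half_graphs[OF _ W B(1)]) (use Requiv B(2) definable_nominal_axioms in blast)+
  then obtain n where n: "\<not> half_graph R X W n" by blast
  \<comment> \<open>Any finitely many translates of \<open>E\<close> belong to the invariant
    ultrafilter together with \<open>Q0\<close>, so they have a common point in \<open>Q0\<close>.
    Bounded half graphs then give finitely many points meeting all translates.\<close>
  have "\<exists>F. finite F \<and> F \<subseteq> Q0 \<and> (\<forall>w\<in>W. \<exists>x\<in>F. R x w)"
  proof (rule finite_hitting_set[of "\<lambda>w x. R x w"])
    have "half_graph R Q0 W n" if "half_graph (\<lambda>w x. R x w) W Q0 n" using half_graph_converse[OF that] by simp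
    then show "\<not> half_graph (\<lambda>w x. R x w) W Q0 n" using n half_graph_mono[OF _ OX order_refl order_refl] by blast
    fix F assume F: "finite F" "F \<subseteq> W"
    have "Q0 \<inter> (\<Inter>w\<in>F. {x \<in> X. R x w}) \<in> \<U>" using F
    proof (induction F rule: finite_induct)
      case (insert w F)
      obtain g where g: "g \<in> \<Gamma>" "w = map g b" using insert.prems by (auto simp: W_def)
      have "act g ` E \<in> \<U>" using inv g(1) E by blast
      moreover have "act g ` E = {x \<in> X. R x w}" using Rg[OF g(1)] g(2) calculation UF(1) fs_pow_subset by blast
      ultimately have "(Q0 \<inter> (\<Inter>w\<in>F. {x \<in> X. R x w})) \<inter> {x \<in> X. R x w} \<in> \<U>" using insert UF(4) by simp
      moreover have "(Q0 \<inter> (\<Inter>w\<in>F. {x \<in> X. R x w})) \<inter> {x \<in> X. R x w} = Q0 \<inter> (\<Inter>w\<in>insert w F. {x \<in> X. R x w})" by blast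
      ultimately show ?case by simp
    qed (use Q0(2) in simp)
    then have "Q0 \<inter> (\<Inter>w\<in>F. {x \<in> X. R x w}) \<noteq> {}" using UF(3) by metis
    then show "\<exists>x\<in>Q0. \<forall>w\<in>F. R x w" by blast
  qed
  then obtain F where F: "finite F" "F \<subseteq> Q0" "\<And>w. w \<in> W \<Longrightarrow> \<exists>x\<in>F. R x w" by blast
  \<comment> \<open>The codes of the translates that contain \<open>x\<close>, viewed from now on as
    supported subsets of \<open>W\<close>.\<close>
  define r where "r x = {w \<in> W. R x w}" for x
  have rP: "r x \<in> ?Q" for x
  proof -
    obtain c where c: "\<forall>\<pi>\<in>fix_grp S (set c). act \<pi> x = x" using ex_supp_list by blast
    show ?thesis
    proof (rule W.fs_powI[of _ "B \<union> set c"])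
      show "supports_set S map (B \<union> set c) (r x)"
      proof (rule N.supports_setI)
        fix \<pi> w assume p: "\<pi> \<in> fix_grp S (B \<union> set c)" "w \<in> r x"
        then have "\<pi> \<in> \<Gamma>" "act \<pi> x = x" using B(2) c fix_grp_mono[of _ "B \<union> set c" S] by blast+
        then show "map \<pi> w \<in> r x" using p(2) Requiv[of \<pi> w x] Winv by (simp add: r_def)
      qed
    qed (use B in \<open>auto simp: r_def\<close>)
  qed
  have r_act: "map g ` r x = r (act g x)" if g: "g \<in> \<Gamma>" for g x
  proof (intro set_eqI iffI)
    fix w assume "w \<in> map g ` r x"
    then show "w \<in> r (act g x)" using Requiv[OF g] Winv[OF g] by (auto simp: r_def)
  next
    fix w assume w: "w \<in> r (act g x)"
    then have "map (inv g) w \<in> W" using Winv G(3)[OF g] by (simp add: r_def)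
    moreover have e: "map g (map (inv g) w) = w" using N.act_inv_right[OF G(1)[OF g]] by simp
    ultimately have "map (inv g) w \<in> r x" using w Requiv[OF g, of "map (inv g) w" x] by (simp add: r_def del: map_map)
    then show "w \<in> map g ` r x" using e by (metis image_eqI)
  qed
  have "map id b \<in> W" using G(4) unfolding W_def by blast
  then have "W \<noteq> {}" by blast
  moreover have "\<forall>g\<in>\<Gamma>. \<forall>w\<in>W. map g w \<in> W" using Winv by blast
  ultimately have "\<exists>I Z G. ideal_on ?Q I \<and> (\<forall>g\<in>\<Gamma>. \<forall>U\<in>I. map g ` U \<in> I) \<and> W \<notin> I \<and>
    Z \<in> ?Q \<and> Z \<notin> I \<and> (\<forall>V\<in>?Q. Z \<inter> V \<in> I \<or> Z - V \<in> I) \<and>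
    finite G \<and> G \<subseteq> \<Gamma> \<and> W - (\<Union>g\<in>G. map g ` Z) \<in> I"
    by (intro N.ex_cofinite_invariant_ideal[OF W _ \<Gamma>])
  then
  obtain I Z H where I: "ideal_on ?Q I" "\<forall>g\<in>\<Gamma>. \<forall>U\<in>I. map g ` U \<in> I" "W \<notin> I"
    and Z: "Z \<in> ?Q" "Z \<notin> I" "\<forall>V\<in>?Q. Z \<inter> V \<in> I \<or> Z - V \<in> I"
    and H: "finite H" "H \<subseteq> \<Gamma>" "W - (\<Union>g\<in>H. map g ` Z) \<in> I" by (elim exE conjE) (rule that)
  note Id = ideal_onD[OF I(1)]
  have "\<exists>x\<in>F. r x \<notin> I"
  proof (rule ccontr)
    assume "\<not> ?thesis"
    then have "(\<Union>x\<in>F. r x) \<in> I" by (intro ideal_on_UN[OF F(1) I(1)]) blast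
    moreover have "(\<Union>x\<in>F. r x) = W" using F(3) by (auto simp: r_def)
    ultimately show False using I(3) by simp
  qed
  then obtain x1 where x1: "x1 \<in> Q0" "r x1 \<notin> I" using F(2) by blast
  \<comment> \<open>The finitely many sets \<open>r x\<close> for \<open>x\<close> in
    \<open>F\<close> cover \<open>W\<close>, so one of them is outside the ideal. Since
    \<open>Q0\<close> is a single orbit and \<open>I\<close> is invariant, this spreads to every
    point of \<open>Q0\<close>.\<close>
  have rI: "r x \<notin> I" if "x \<in> Q0" for x
  proof
    assume rx: "r x \<in> I"
    obtain g h where gh: "g \<in> \<Gamma>" "x = act g x0" "h \<in> \<Gamma>" "x1 = act h x0" using \<open>x \<in> Q0\<close> x1(1) Q0(1) by blast
    then have "act (h \<circ> inv g) x = x1" using act_comp G(1,3) act_inv_left by metis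
    moreover have "h \<circ> inv g \<in> \<Gamma>" using gh G by blast
    ultimately have "r x1 \<in> I" using I(2) rx r_act by metis
    then show False using x1(2) by simp
  qed
  \<comment> \<open>Because \<open>Z\<close> is an atom modulo \<open>I\<close>, this condition says
    that the translate of \<open>Z\<close> by \<open>g\<close> lies inside \<open>r x\<close> up to
    a member of \<open>I\<close>.\<close>
  define Y where "Y g = {x \<in> Q0. r x \<inter> map g ` Z \<notin> I}" for g
  have OY: "Q0 \<subseteq> (\<Union>g\<in>H. Y g)"
  proof
    fix x assume x: "x \<in> Q0"
    have "\<exists>g\<in>H. r x \<inter> map g ` Z \<notin> I"
    proof (rule ccontr)
      assume "\<not> ?thesis"
      then have "(\<Union>g\<in>H. r x \<inter> map g ` Z) \<in> I" by (intro ideal_on_UN[OF H(1) I(1)]) blast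
      then have "(W - (\<Union>g\<in>H. map g ` Z)) \<union> (\<Union>g\<in>H. r x \<inter> map g ` Z) \<in> I" using H(3) Id(3) by blast
      moreover have "r x \<subseteq> (W - (\<Union>g\<in>H. map g ` Z)) \<union> (\<Union>g\<in>H. r x \<inter> map g ` Z)" by (auto simp: r_def)
      ultimately have "r x \<in> I" using Id(4) rP by blast
      then show False using rI x by blast
    qed
    then show "x \<in> (\<Union>g\<in>H. Y g)" using x by (auto simp: Y_def)
  qed
  \<comment> \<open>Second use of the hitting lemma, with the roles exchanged. For finitely many
    points of \<open>Y g\<close>, the translate of \<open>Z\<close> loses only a member of
    \<open>I\<close> outside their sets \<open>r x\<close>, so some code in it relates to all of
    them at once.\<close>
  have "\<exists>G'. finite G' \<and> G' \<subseteq> W \<and> (\<forall>x\<in>Y g. \<exists>w\<in>G'. R x w)" if g: "g \<in> H" for g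
  proof (rule finite_hitting_set)
    have "Y g \<subseteq> X" using OX by (auto simp: Y_def)
    then show "\<not> half_graph R (Y g) W n" using n half_graph_mono[OF _ _ order_refl order_refl] by blast
    have gG: "g \<in> \<Gamma>" using g H(2) by blast
    have ZW: "map g ` Z \<subseteq> W" using Z(1) W.fs_pow_subset Winv[OF gG] by blast
    fix K assume K: "finite K" "K \<subseteq> Y g"
    have "map g ` Z - r x \<in> I" if "x \<in> K" for x
    proof -
      define V where "V = r (act (inv g) x)"
      have gV: "map g ` V = r x" using r_act[OF gG] act_inv_right[OF G(1)[OF gG]] by (simp add: V_def)
      have "map g ` (Z \<inter> V) = map g ` Z \<inter> r x" "map g ` (Z - V) = map g ` Z - r x"
        using image_Int[OF N.inj_act[OF G(1)[OF gG]]] image_set_diff[OF N.inj_act[OF G(1)[OF gG]]] gV by simp_all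
      moreover have "Z \<inter> V \<in> I \<or> Z - V \<in> I" using Z(3) rP by (simp add: V_def)
      ultimately have "map g ` Z \<inter> r x \<in> I \<or> map g ` Z - r x \<in> I" using I(2) gG by metis
      then show ?thesis using K(2) that by (auto simp: Y_def Int_commute)
    qed
    then have KI: "(\<Union>x\<in>K. map g ` Z - r x) \<in> I" by (rule ideal_on_UN[OF K(1) I(1)])
    have "map g ` Z \<notin> I"
    proof
      assume "map g ` Z \<in> I"
      then have "map (inv g) ` map g ` Z \<in> I" using I(2) G(3)[OF gG] by blast
      then show False using Z(2) N.image_act_inv(1)[OF G(1)[OF gG]] by metis
    qed
    then have "\<not> map g ` Z \<subseteq> (\<Union>x\<in>K. map g ` Z - r x)" using KI by (metis (no_types, lifting) Diff_subset UN_least subset_antisym)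
    then show "\<exists>w\<in>W. \<forall>x\<in>K. R x w" using ZW by (auto simp: r_def)
  qed
  then have "\<forall>g\<in>H. \<exists>G'. finite G' \<and> G' \<subseteq> W \<and> (\<forall>x\<in>Y g. \<exists>w\<in>G'. R x w)" by blast
  then obtain K where K: "\<forall>g\<in>H. finite (K g) \<and> K g \<subseteq> W \<and> (\<forall>x\<in>Y g. \<exists>w\<in>K g. R x w)"
    unfolding bchoice_iff by (elim exE)
  have "\<forall>w\<in>W. \<exists>g. g \<in> \<Gamma> \<and> w = map g b" by (auto simp: W_def)
  then obtain k where k: "\<forall>w\<in>W. k w \<in> \<Gamma> \<and> w = map (k w) b" unfolding bchoice_iff by (elim exE)
  have "Q0 \<subseteq> (\<Union>g\<in>k ` (\<Union>g\<in>H. K g). act g ` E)"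
  proof
    fix x assume "x \<in> Q0"
    then obtain g where g: "g \<in> H" "x \<in> Y g" using OY by blast
    then obtain w where w: "w \<in> K g" "R x w" using K by blast
    then have "k w \<in> \<Gamma>" "w = map (k w) b" using k K g(1) by blast+
    then have "x \<in> act (k w) ` E" using Rg w(2) by metis
    then show "x \<in> (\<Union>g\<in>k ` (\<Union>g\<in>H. K g). act g ` E)" using g(1) w(1) by blast
  qed
  moreover have "k ` (\<Union>g\<in>H. K g) \<subseteq> \<Gamma>" using k K by blast
  moreover have "finite (k ` (\<Union>g\<in>H. K g))" using H(1) K by blast
  ultimately show ?thesis by blast
qed

end

section \<open>The core of an ultrafilter\<close>

context definable_nominal
begin

abbreviation SC where "SC \<equiv> stone_cech S act X"

definition stab :: "'x set set \<Rightarrow> ('a \<Rightarrow> 'a) set" where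
  "stab \<U> = {\<pi> \<in> fix_grp S A0. act_uf act \<pi> \<U> = \<U>}"

definition orb :: "('a \<Rightarrow> 'a) set \<Rightarrow> 'x \<Rightarrow> 'x set" where
  "orb \<Gamma> x = {act g x | g. g \<in> \<Gamma>}"

text \<open>Stated pointwise, without choosing the orbit, so that it can be transported along
  automorphisms.\<close>

definition core :: "'x set set \<Rightarrow> 'x set" where
  "core \<U> = {x \<in> X. orb (stab \<U>) x \<in> \<U>}"

lemma act_uf_comp:
  "aut S \<pi> \<Longrightarrow> aut S \<sigma> \<Longrightarrow> act_uf act (\<pi> \<circ> \<sigma>) \<U> = act_uf act \<pi> (act_uf act \<sigma> \<U>)"
  by (simp add: act_uf_def act_set_def image_act_comp image_image)

lemma act_uf_id [simp]: "act_uf act id \<U> = \<U>"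
  by (simp add: act_uf_def act_set_def)

lemma act_uf_inv [simp]:
  assumes "aut S \<pi>"
  shows "act_uf act (inv \<pi>) (act_uf act \<pi> \<U>) = \<U>" "act_uf act \<pi> (act_uf act (inv \<pi>) \<U>) = \<U>"
  using assms by (simp_all add: aut_inv aut_inv_comp flip: act_uf_comp)

lemma SC_ultrafilter: "\<U> \<in> SC \<Longrightarrow> ultrafilter_on P X \<U>"
  by (simp add: stone_cech_def)

lemma SC_act:
  assumes U: "\<U> \<in> SC" and p: "\<pi> \<in> fix_grp S A0"
  shows "act_uf act \<pi> \<U> \<in> SC"
proof -
  note UF = ultrafilter_onD[OF SC_ultrafilter[OF U]]
  have a: "aut S \<pi>" "aut S (inv \<pi>)" using p fix_grp_aut aut_inv by blast+
  note pinv = fix_grp_inv[OF p]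
  note mem = act_uf_mem_iff[OF a(1)]
  have X: "act (inv \<pi>) ` X = X" using supports_setD[OF supp_X pinv] .
  have "ultrafilter_on P X (act_uf act \<pi> \<U>)"
    unfolding ultrafilter_on_def mem
  proof (intro conjI ballI impI subsetI)
    fix E assume "E \<in> act_uf act \<pi> \<U>"
    then have "act (inv \<pi>) ` E \<in> P" using UF(1) mem by blast
    then have "act \<pi> ` act (inv \<pi>) ` E \<in> P" using fs_pow_image[OF _ p] by blast
    then show "E \<in> P" using a(1) by simp
  next
    fix E F assume "E \<in> act_uf act \<pi> \<U>" "F \<in> act_uf act \<pi> \<U>"
    then show "act (inv \<pi>) ` (E \<inter> F) \<in> \<U>" using UF(4) mem image_Int[OF inj_act[OF a(2)]] by simp
  next
    fix E F assume "E \<in> act_uf act \<pi> \<U>" "F \<in> P" "E \<subseteq> F"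
    then show "act (inv \<pi>) ` F \<in> \<U>"
      using UF(5)[of "act (inv \<pi>) ` E" "act (inv \<pi>) ` F"] mem fs_pow_image[OF _ pinv] by blast
  next
    fix E assume "E \<in> P"
    then show "act (inv \<pi>) ` E \<in> \<U> \<or> act (inv \<pi>) ` (X - E) \<in> \<U>"
      using UF(6)[of "act (inv \<pi>) ` E"] X image_set_diff[OF inj_act[OF a(2)]] fs_pow_image[OF _ pinv] by simp
  qed (use UF(2,3) X in auto)
  moreover have "\<exists>B. finite B \<and> (\<forall>\<sigma>\<in>fix_grp S B. act_uf act \<sigma> (act_uf act \<pi> \<U>) = act_uf act \<pi> \<U>)"
  proof -
    obtain B where B: "finite B" "\<forall>\<sigma>\<in>fix_grp S B. act_uf act \<sigma> \<U> = \<U>"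
      using U by (auto simp: stone_cech_def)
    have "act_uf act \<sigma> (act_uf act \<pi> \<U>) = act_uf act \<pi> \<U>" if s: "\<sigma> \<in> fix_grp S (\<pi> ` B)" for \<sigma>
    proof -
      have as: "aut S \<sigma>" using s fix_grp_aut by blast
      have i: "inv \<pi> (\<pi> x) = x" for x using a(1) by (simp add: aut_def bij_is_inj)
      have "inv \<pi> \<circ> (\<sigma> \<circ> \<pi>) \<in> fix_grp S B"
        using s a as i by (auto simp: fix_grp_def intro!: aut_comp)
      then have "act_uf act (inv \<pi> \<circ> (\<sigma> \<circ> \<pi>)) \<U> = \<U>" using B(2) by blast
      then have "act_uf act (inv \<pi>) (act_uf act \<sigma> (act_uf act \<pi> \<U>)) = \<U>"
        using a as by (simp add: act_uf_comp aut_comp)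
      then show ?thesis using act_uf_inv(2)[OF a(1)] by metis
    qed
    then show ?thesis using B(1) by (intro exI[of _ "\<pi> ` B"]) simp
  qed
  ultimately show ?thesis by (simp add: stone_cech_def)
qed

lemma open_subgroup_stab:
  assumes "\<U> \<in> SC"
  shows "open_subgroup S (stab \<U>)"
proof -
  obtain B where B: "finite B" "\<forall>\<sigma>\<in>fix_grp S B. act_uf act \<sigma> \<U> = \<U>"
    using assms by (auto simp: stone_cech_def)
  have "fix_grp S (A0 \<union> B) \<subseteq> stab \<U>"
    using B(2) fix_grp_mono[of A0 "A0 \<union> B" S] fix_grp_mono[of B "A0 \<union> B" S] by (auto simp: stab_def)
  moreover have "finite (A0 \<union> B)" using fin_A0 B(1) by simp
  moreover have "inv \<pi> \<in> stab \<U>" if "\<pi> \<in> stab \<U>" for \<pi>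
    using that act_uf_inv(1)[OF fix_grp_aut, of \<pi> A0 \<U>] fix_grp_inv[of \<pi> S A0] by (auto simp: stab_def)
  moreover have "\<pi> \<circ> \<sigma> \<in> stab \<U>" if "\<pi> \<in> stab \<U>" "\<sigma> \<in> stab \<U>" for \<pi> \<sigma>
    using that act_uf_comp[OF fix_grp_aut fix_grp_aut, of \<pi> A0 \<sigma> A0 \<U>] fix_grp_comp by (auto simp: stab_def)
  moreover have "\<forall>\<pi>\<in>stab \<U>. aut S \<pi>" using fix_grp_aut by (auto simp: stab_def)
  ultimately show ?thesis unfolding open_subgroup_def by blast
qed

lemma stab_image_mem:
  assumes "g \<in> stab \<U>" "E \<in> \<U>"
  shows "act g ` E \<in> \<U>"
proof -
  have "act_set act g E \<in> act_uf act g \<U>" unfolding act_uf_def using assms(2) by blast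
  then show ?thesis using assms(1) by (simp add: stab_def act_set_def)
qed

text \<open>The stabilizer contains some \<open>fix_grp S B\<close>, so its orbits are unions of the
  finitely many orbits over \<open>B\<close>. An ultrafilter contains exactly one block of a finite
  partition into supported sets.\<close>

lemma core_eq_orb:
  assumes U: "\<U> \<in> SC"
  shows "\<exists>x\<in>X. core \<U> = orb (stab \<U>) x \<and> core \<U> \<in> \<U>"
proof -
  let ?\<Gamma> = "stab \<U>"
  note G = open_subgroupD[OF open_subgroup_stab[OF U]] and UF = ultrafilter_onD[OF SC_ultrafilter[OF U]]
  obtain B where B: "finite B" "fix_grp S B \<subseteq> ?\<Gamma>"
    using open_subgroup_stab[OF U] unfolding open_subgroup_def by blast
  have sub: "act g x \<in> X" if "g \<in> ?\<Gamma>" "x \<in> X" for g x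
    using that supports_set_mem[OF supp_X] by (auto simp: stab_def)
  have orb_act: "act h y \<in> orb ?\<Gamma> x" if hy: "h \<in> ?\<Gamma>" "y \<in> orb ?\<Gamma> x" for h x y
  proof -
    obtain g where "g \<in> ?\<Gamma>" "y = act g x" using hy(2) by (auto simp: orb_def)
    then have "h \<circ> g \<in> ?\<Gamma>" "act h y = act (h \<circ> g) x" using hy(1) G(1,2) act_comp by auto
    then show ?thesis unfolding orb_def by blast
  qed
  have orb_self: "x \<in> orb ?\<Gamma> x" for x
    using G(4) act_id unfolding orb_def by (metis (mono_tags, lifting) mem_Collect_eq)
  have orb_sym: "x \<in> orb ?\<Gamma> y" if xy: "y \<in> orb ?\<Gamma> x" for x y
  proof -
    obtain g where "g \<in> ?\<Gamma>" "y = act g x" using xy by (auto simp: orb_def)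
    then have "act (inv g) y = x" "inv g \<in> ?\<Gamma>" using G(1,3) by auto
    then show ?thesis unfolding orb_def by blast
  qed
  have orb_sub: "orb ?\<Gamma> y \<subseteq> orb ?\<Gamma> x" if "y \<in> orb ?\<Gamma> x" for x y
    using orb_act[OF _ that] by (auto simp: orb_def[of _ y])
  have orbP: "orb ?\<Gamma> x \<in> P" if "x \<in> X" for x
  proof (rule fs_powI[OF _ B(1)])
    show "orb ?\<Gamma> x \<subseteq> X" using sub that by (auto simp: orb_def)
    show "supports_set S act B (orb ?\<Gamma> x)" by (rule supports_setI) (use orb_act B(2) in blast)
  qed
  \<comment> \<open>The orbits of the stabilizer are indexed by orbits over \<open>B\<close>,
    possibly with repetitions, to make the union visibly finite.\<close>
  have "(\<Union>T\<in>(\<lambda>x. orbit S act B x) ` X. orb ?\<Gamma> (SOME y. y \<in> T)) = X"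
  proof (intro equalityI subsetI)
    fix x assume x: "x \<in> X"
    let ?y = "SOME y. y \<in> orbit S act B x"
    have "x \<in> orbit S act B x" by (rule orbit_self)
    then have "?y \<in> orbit S act B x" by (rule someI)
    then have "?y \<in> orb ?\<Gamma> x" using B(2) by (auto simp: orbit_def orb_def)
    then have "x \<in> orb ?\<Gamma> ?y" by (rule orb_sym)
    then show "x \<in> (\<Union>T\<in>(\<lambda>x. orbit S act B x) ` X. orb ?\<Gamma> (SOME y. y \<in> T))" using x by blast
  next
    fix z assume "z \<in> (\<Union>T\<in>(\<lambda>x. orbit S act B x) ` X. orb ?\<Gamma> (SOME y. y \<in> T))"
    then obtain x where x: "x \<in> X" "z \<in> orb ?\<Gamma> (SOME y. y \<in> orbit S act B x)" by blast
    have "x \<in> orbit S act B x" by (rule orbit_self)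
    then have "(SOME y. y \<in> orbit S act B x) \<in> orbit S act B x" by (rule someI)
    then have "(SOME y. y \<in> orbit S act B x) \<in> orb ?\<Gamma> x" using B(2) by (auto simp: orbit_def orb_def)
    then show "z \<in> X" using x orb_sub fs_pow_subset[OF orbP[OF x(1)]] by blast
  qed
  moreover have "orb ?\<Gamma> (SOME y. y \<in> T) \<in> P" if T: "T \<in> (\<lambda>x. orbit S act B x) ` X" for T
  proof -
    obtain x where x: "x \<in> X" "T = orbit S act B x" using T by blast
    have "x \<in> T" unfolding x(2) by (rule orbit_self)
    then have "(SOME y. y \<in> T) \<in> T" by (rule someI)
    then have "(SOME y. y \<in> T) \<in> orb ?\<Gamma> x" using B(2) by (auto simp: x(2) orbit_def orb_def)
    then show ?thesis using orbP fs_pow_subset[OF orbP[OF x(1)]] by blast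
  qed
  ultimately have "\<exists>T\<in>(\<lambda>x. orbit S act B x) ` X. orb ?\<Gamma> (SOME y. y \<in> T) \<in> \<U>"
    using ultrafilter_UN[OF SC_ultrafilter[OF U] finite_orbits[OF B(1)], of "\<lambda>T. orb ?\<Gamma> (SOME y. y \<in> T)"] UF(2) by simp
  then obtain x where x: "orb ?\<Gamma> x \<in> \<U>" by blast
  then have xX: "x \<in> X" using UF(1) fs_pow_subset orb_self by blast
  have "core \<U> = orb ?\<Gamma> x"
  proof (intro equalityI subsetI)
    fix y assume y: "y \<in> core \<U>"
    then have "orb ?\<Gamma> y \<inter> orb ?\<Gamma> x \<in> \<U>" using x UF(4) by (simp add: core_def)
    then have "orb ?\<Gamma> y \<inter> orb ?\<Gamma> x \<noteq> {}" using UF(3) by metis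
    then obtain z where "z \<in> orb ?\<Gamma> y" "z \<in> orb ?\<Gamma> x" by blast
    then show "y \<in> orb ?\<Gamma> x" using orb_sym orb_sub by blast
  next
    fix y assume y: "y \<in> orb ?\<Gamma> x"
    then have "orb ?\<Gamma> y = orb ?\<Gamma> x" using orb_sub orb_sym by blast
    moreover have "y \<in> X" using y fs_pow_subset[OF orbP[OF xX]] by blast
    ultimately show "y \<in> core \<U>" using x by (simp add: core_def)
  qed
  then show ?thesis using x xX by auto
qed

lemma core_mem: "\<U> \<in> SC \<Longrightarrow> core \<U> \<in> \<U>"
  using core_eq_orb by blast

lemma core_in_P: "\<U> \<in> SC \<Longrightarrow> core \<U> \<in> P"
  using core_mem ultrafilter_onD(1)[OF SC_ultrafilter] by blast

text \<open>The stabilizer of a translated ultrafilter is the conjugate subgroup, so its orbits are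
  the translated orbits.\<close>

lemma core_act:
  assumes U: "\<U> \<in> SC" and p: "\<pi> \<in> fix_grp S A0"
  shows "act \<pi> x \<in> core (act_uf act \<pi> \<U>) \<longleftrightarrow> x \<in> core \<U>"
proof -
  have a: "aut S \<pi>" "aut S (inv \<pi>)" using p fix_grp_aut aut_inv by blast+
  have st: "\<sigma> \<in> stab (act_uf act \<pi> \<U>) \<longleftrightarrow> inv \<pi> \<circ> \<sigma> \<circ> \<pi> \<in> stab \<U>" if s: "\<sigma> \<in> fix_grp S A0" for \<sigma>
  proof -
    have as: "aut S \<sigma>" using s fix_grp_aut by blast
    have "inv \<pi> \<circ> \<sigma> \<circ> \<pi> \<in> fix_grp S A0" using s p fix_grp_comp fix_grp_inv by blast
    moreover have "act_uf act (inv \<pi> \<circ> \<sigma> \<circ> \<pi>) \<U> = act_uf act (inv \<pi>) (act_uf act \<sigma> (act_uf act \<pi> \<U>))"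
      using a as by (simp add: act_uf_comp aut_comp)
    ultimately show ?thesis using s act_uf_inv[OF a(1)] by (simp add: stab_def) metis
  qed
  have "act (inv \<pi>) ` orb (stab (act_uf act \<pi> \<U>)) (act \<pi> x) = orb (stab \<U>) x"
  proof (intro equalityI subsetI)
    fix y assume "y \<in> act (inv \<pi>) ` orb (stab (act_uf act \<pi> \<U>)) (act \<pi> x)"
    then obtain \<sigma> where s: "\<sigma> \<in> stab (act_uf act \<pi> \<U>)" "y = act (inv \<pi>) (act \<sigma> (act \<pi> x))"
      by (auto simp: orb_def)
    then have "\<sigma> \<in> fix_grp S A0" by (simp add: stab_def)
    then have "inv \<pi> \<circ> \<sigma> \<circ> \<pi> \<in> stab \<U>" "y = act (inv \<pi> \<circ> \<sigma> \<circ> \<pi>) x"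
      using s st a by (auto simp: act_comp aut_comp fix_grp_aut)
    then show "y \<in> orb (stab \<U>) x" unfolding orb_def by blast
  next
    fix y assume "y \<in> orb (stab \<U>) x"
    then obtain \<tau> where t: "\<tau> \<in> stab \<U>" "y = act \<tau> x" by (auto simp: orb_def)
    define \<sigma> where "\<sigma> = \<pi> \<circ> \<tau> \<circ> inv \<pi>"
    have tA: "\<tau> \<in> fix_grp S A0" "aut S \<tau>" using t(1) fix_grp_aut by (auto simp: stab_def)
    have sA: "\<sigma> \<in> fix_grp S A0" unfolding \<sigma>_def using tA(1) p fix_grp_comp fix_grp_inv by blast
    have "inv \<pi> \<circ> \<sigma> \<circ> \<pi> = (inv \<pi> \<circ> \<pi>) \<circ> \<tau> \<circ> (inv \<pi> \<circ> \<pi>)" by (simp add: \<sigma>_def comp_assoc)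
    also have "\<dots> = \<tau>" using aut_inv_comp(1)[OF a(1)] by simp
    finally have e: "inv \<pi> \<circ> \<sigma> \<circ> \<pi> = \<tau>" .
    then have "\<sigma> \<in> stab (act_uf act \<pi> \<U>)" using st[OF sA] t(1) by simp
    moreover have "y = act (inv \<pi>) (act \<sigma> (act \<pi> x))"
      using a tA by (simp add: \<sigma>_def act_comp aut_comp t(2))
    ultimately show "y \<in> act (inv \<pi>) ` orb (stab (act_uf act \<pi> \<U>)) (act \<pi> x)" unfolding orb_def by blast
  qed
  then show ?thesis
    unfolding core_def using act_uf_mem_iff[OF a(1)] supports_set_mem[OF supp_X p] by simp
qed

text \<open>In model-theoretic terms, cores are stationary of the rank of their ultrafilter, so this relation
  strictly decreases Morley rank; its well-foundedness replaces induction on the rank.\<close>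

definition below :: "('x set set \<times> 'x set set) set" where
  "below = {(\<V>, \<U>). \<V> \<in> SC \<and> \<U> \<in> SC \<and> \<V> \<noteq> \<U> \<and> core \<U> \<in> \<V>}"

lemma below_act:
  assumes "(\<V>, \<U>) \<in> below" and p: "\<pi> \<in> fix_grp S A0"
  shows "(act_uf act \<pi> \<V>, act_uf act \<pi> \<U>) \<in> below"
proof -
  have a: "aut S \<pi>" using p fix_grp_aut by blast
  have UV: "\<V> \<in> SC" "\<U> \<in> SC" "\<V> \<noteq> \<U>" "core \<U> \<in> \<V>" using assms(1) by (auto simp: below_def)
  have "x \<in> core (act_uf act \<pi> \<U>) \<longleftrightarrow> act (inv \<pi>) x \<in> core \<U>" for x
    using core_act[OF UV(2) p, of "act (inv \<pi>) x"] a by simp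
  then have "core (act_uf act \<pi> \<U>) = act \<pi> ` core \<U>" using mem_image_act[OF a] by blast
  then have "core (act_uf act \<pi> \<U>) \<in> act_uf act \<pi> \<V>" using UV(4) act_uf_mem_iff[OF a] a by simp
  moreover have "act_uf act \<pi> \<V> \<noteq> act_uf act \<pi> \<U>" using UV(3) act_uf_inv(1)[OF a] by metis
  ultimately show ?thesis using UV SC_act[OF _ p] by (simp add: below_def)
qed

theorem wf_below: "wf below"
proof (rule wfI_min, rule ccontr)
  fix \<U>0 Q assume U0: "\<U>0 \<in> Q" and nomin: "\<not> (\<exists>\<U>\<in>Q. \<forall>\<V>. (\<V>, \<U>) \<in> below \<longrightarrow> \<V> \<notin> Q)"
  \<comment> \<open>The set of ultrafilters is first closed under translation, since below it is a
    translate of \<open>\<V>\<close>, and not \<open>\<V>\<close> itself, that has to supply a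
    member of the tree.\<close>
  define Q' where "Q' = {act_uf act \<pi> \<U> | \<pi> \<U>. \<pi> \<in> fix_grp S A0 \<and> \<U> \<in> Q}"
  have Q'act: "act_uf act \<pi> \<U> \<in> Q'" if pU: "\<pi> \<in> fix_grp S A0" "\<U> \<in> Q'" for \<pi> \<U>
  proof -
    obtain \<sigma> \<V> where s: "\<sigma> \<in> fix_grp S A0" "\<V> \<in> Q" "\<U> = act_uf act \<sigma> \<V>" using pU(2) unfolding Q'_def by blast
    then have "act_uf act \<pi> \<U> = act_uf act (\<pi> \<circ> \<sigma>) \<V>" "\<pi> \<circ> \<sigma> \<in> fix_grp S A0"
      using pU(1) by (auto simp: act_uf_comp fix_grp_aut fix_grp_comp)
    then show ?thesis using s(2) unfolding Q'_def by blast
  qed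
  have Q'below: "\<exists>\<V>\<in>Q'. (\<V>, \<U>) \<in> below" if U: "\<U> \<in> Q'" for \<U>
  proof -
    obtain \<pi> \<W> where w: "\<pi> \<in> fix_grp S A0" "\<W> \<in> Q" "\<U> = act_uf act \<pi> \<W>" using U unfolding Q'_def by blast
    then obtain \<V> where "\<V> \<in> Q" "(\<V>, \<W>) \<in> below" using nomin by blast
    then have "act_uf act \<pi> \<V> \<in> Q'" "(act_uf act \<pi> \<V>, \<U>) \<in> below"
      using w below_act unfolding Q'_def by blast+
    then show ?thesis by blast
  qed
  \<comment> \<open>\<open>Q\<close> is an arbitrary set; having something below it is what makes a
    member a genuine ultrafilter.\<close>
  have Q'SC: "\<U> \<in> SC" if "\<U> \<in> Q'" for \<U> using Q'below[OF that] by (auto simp: below_def)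
  let ?\<B> = "{E. \<exists>\<U>\<in>Q'. E \<in> \<U>}"
  have Uf: "ultrafilter_on P X \<U>" if "\<U> \<in> Q'" for \<U> using Q'SC[OF that] SC_ultrafilter by blast
  have "\<U>0 \<in> Q'" using U0 unfolding Q'_def
    by (auto intro!: exI[of _ id] exI[of _ \<U>0] simp: fix_grp_def aut_id)
  show False
  proof (rule no_perfect_tree[of ?\<B> X])
    show "?\<B> \<subseteq> P" using ultrafilter_onD(1)[OF Uf] by blast
    show "X \<in> ?\<B>" using ultrafilter_onD(2)[OF Uf] \<open>\<U>0 \<in> Q'\<close> by blast
    show "{} \<notin> ?\<B>" using ultrafilter_onD(3)[OF Uf] by blast
    fix E assume "E \<in> ?\<B>"
    then obtain \<U> where U: "\<U> \<in> Q'" "E \<in> \<U>" by blast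
    have USC: "\<U> \<in> SC" using Q'SC U(1) by blast
    obtain \<V> where V: "\<V> \<in> Q'" "(\<V>, \<U>) \<in> below" using Q'below U(1) by blast
    obtain x where x: "core \<U> = orb (stab \<U>) x" "core \<U> \<in> \<U>" using core_eq_orb[OF USC] by blast
    have "\<exists>T. finite T \<and> T \<subseteq> stab \<U> \<and> core \<U> \<subseteq> (\<Union>g\<in>T. act g ` E)"
      by (rule finitely_many_translates_cover[OF open_subgroup_stab[OF USC] SC_ultrafilter[OF USC]
            stab_image_mem _ x(2) U(2)]) (use x(1) in \<open>auto simp: orb_def\<close>)
    then obtain T where T: "finite T" "T \<subseteq> stab \<U>" "core \<U> \<subseteq> (\<Union>g\<in>T. act g ` E)" by blast
    have EP: "E \<in> P" using ultrafilter_onD(1)[OF Uf[OF U(1)]] U(2) by blast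
    have gP: "act g ` E \<in> P" if "g \<in> T" for g using that T(2) fs_pow_image[OF EP] by (auto simp: stab_def)
    have "(\<Union>g\<in>T. act g ` E) \<in> \<V>"
      using ultrafilter_onD(5)[OF Uf[OF V(1)] _ fs_pow_UN[OF T(1) gP] T(3)] V(2) by (simp add: below_def)
    then have "\<exists>g\<in>T. act g ` E \<in> \<V>" by (intro ultrafilter_UN[OF Uf[OF V(1)] T(1) gP])
    then obtain g where g: "g \<in> T" "act g ` E \<in> \<V>" by blast
    then have gs: "g \<in> stab \<U>" "g \<in> fix_grp S A0" using T(2) by (auto simp: stab_def)
    then have "aut S g" using fix_grp_aut by blast
    note gs = gs this
    \<comment> \<open>Moving \<open>\<V>\<close> back by \<open>g\<close> puts \<open>E\<close>
      itself into it. The result still differs from \<open>\<U>\<close>: as \<open>g\<close>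
      stabilizes \<open>\<U>\<close>, equality would give \<open>\<V> = \<U>\<close>.\<close>
    define \<V>' where "\<V>' = act_uf act (inv g) \<V>"
    have gV: "act_uf act g \<V>' = \<V>" unfolding \<V>'_def using gs(3) by simp
    have V': "\<V>' \<in> Q'" unfolding \<V>'_def using Q'act[OF fix_grp_inv[OF gs(2)] V(1)] .
    have "act (inv g) ` act g ` E \<in> \<V>'"
      unfolding \<V>'_def act_uf_def act_set_def using g(2) by blast
    then have EV: "E \<in> \<V>'" using gs(3) by simp
    have "\<V>' \<noteq> \<U>" using V(2) gV gs(1) by (auto simp: below_def stab_def)
    have "\<exists>D\<in>P. D \<in> \<U> \<and> D \<notin> \<V>'"
    proof (rule ccontr)
      assume "\<not> ?thesis"
      then have sub: "\<U> \<subseteq> \<V>'" using ultrafilter_onD(1)[OF Uf[OF U(1)]] by blast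
      have "D \<in> \<U>" if D: "D \<in> \<V>'" for D
      proof (rule ccontr)
        assume "D \<notin> \<U>"
        then have "X - D \<in> \<V>'" using sub ultrafilter_onD(6)[OF Uf[OF U(1)], of D] ultrafilter_onD(1)[OF Uf[OF V']] D by blast
        then have "D \<inter> (X - D) \<in> \<V>'" using ultrafilter_onD(4)[OF Uf[OF V'] D] by blast
        then show False using ultrafilter_onD(3)[OF Uf[OF V']] by simp
      qed
      then show False using sub \<open>\<V>' \<noteq> \<U>\<close> by blast
    qed
    then obtain D where D: "D \<in> P" "D \<in> \<U>" "D \<notin> \<V>'" by blast
    have "E \<inter> D \<in> \<U>" using U(2) D(2) ultrafilter_onD(4)[OF Uf[OF U(1)]] by blast
    moreover have "E - D \<in> \<V>'" using ultrafilter_Diff[OF Uf[OF V'] EV D(1,3)] .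
    ultimately show "\<exists>E1\<in>?\<B>. \<exists>E2\<in>?\<B>. E1 \<subseteq> E \<and> E2 \<subseteq> E \<and> E1 \<inter> E2 = {}"
      using U(1) V' by (intro bexI[of _ "E \<inter> D"] bexI[of _ "E - D"]) auto
  qed
qed

end

section \<open>Indicators of cores form a basis\<close>

context definable_nominal
begin

section \<open>The linear extension of the core indicators and its injectivity\<close>

definition core_sum :: "('x set set \<Rightarrow> 'k::field) \<Rightarrow> 'x \<Rightarrow> 'k" where
  "core_sum v x = (\<Sum>\<U> | v \<U> \<noteq> 0. if x \<in> core \<U> then v \<U> else 0)"

lemma core_sum_superset:
  "finite T \<Longrightarrow> {\<U>. v \<U> \<noteq> 0} \<subseteq> T \<Longrightarrow> core_sum v x = (\<Sum>\<U>\<in>T. if x \<in> core \<U> then v \<U> else 0)"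
  unfolding core_sum_def by (rule sum.mono_neutral_left) auto

lemma free_vs_add: "v \<in> free_vs Y \<Longrightarrow> w \<in> free_vs Y \<Longrightarrow> (\<lambda>u. v u + w u) \<in> free_vs Y"
proof -
  have "{u. v u + w u \<noteq> 0} \<subseteq> {u. v u \<noteq> 0} \<union> {u. w u \<noteq> 0}" by auto
  then show "v \<in> free_vs Y \<Longrightarrow> w \<in> free_vs Y \<Longrightarrow> (\<lambda>u. v u + w u) \<in> free_vs Y"
    unfolding free_vs_def by (auto dest: finite_subset)
qed

lemma free_vs_scale: "v \<in> free_vs Y \<Longrightarrow> (\<lambda>u. c * v u) \<in> free_vs Y"
  unfolding free_vs_def by (auto intro: finite_subset[of _ "{u. v u \<noteq> 0}"])

lemma core_sum_add:
  assumes "v \<in> free_vs SC" "w \<in> free_vs SC"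
  shows "core_sum (\<lambda>u. v u + w u) x = core_sum v x + core_sum w x"
proof -
  let ?T = "{u. v u \<noteq> 0} \<union> {u. w u \<noteq> 0}"
  have T: "finite ?T" using assms by (simp add: free_vs_def)
  have "core_sum (\<lambda>u. v u + w u) x = (\<Sum>u\<in>?T. if x \<in> core u then v u + w u else 0)"
    by (rule core_sum_superset[OF T]) auto
  also have "\<dots> = (\<Sum>u\<in>?T. (if x \<in> core u then v u else 0) + (if x \<in> core u then w u else 0))"
    by (rule sum.cong) auto
  also have "\<dots> = core_sum v x + core_sum w x"
    unfolding sum.distrib by (subst (1 2) core_sum_superset[OF T]) auto
  finally show ?thesis .
qed

lemma core_sum_scale:
  assumes "v \<in> free_vs SC"
  shows "core_sum (\<lambda>u. c * v u) x = c * core_sum v x"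
proof -
  have T: "finite {u. v u \<noteq> 0}" using assms by (simp add: free_vs_def)
  have "core_sum (\<lambda>u. c * v u) x = (\<Sum>u | v u \<noteq> 0. if x \<in> core u then c * v u else 0)"
    by (rule core_sum_superset[OF T]) auto
  also have "\<dots> = c * core_sum v x"
    unfolding core_sum_def sum_distrib_left by (rule sum.cong) auto
  finally show ?thesis .
qed

text \<open>Reindexing the sum along the bijection \<open>act_uf act \<pi>\<close> turns translated
  coefficients into a translated argument, by equivariance of cores.\<close>

lemma core_sum_act:
  assumes v: "v \<in> free_vs SC" and p: "\<pi> \<in> fix_grp S A0"
  shows "(\<lambda>u. v (act_uf act \<pi> u)) \<in> free_vs SC"
    and "core_sum (\<lambda>u. v (act_uf act \<pi> u)) x = core_sum v (act \<pi> x)"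
proof -
  have a: "aut S \<pi>" using p fix_grp_aut by blast
  have b: "bij_betw (act_uf act \<pi>) {u. v (act_uf act \<pi> u) \<noteq> 0} {u. v u \<noteq> 0}"
    by (rule bij_betw_byWitness[where f' = "act_uf act (inv \<pi>)"]) (use a in auto)
  have fin: "finite {u. v u \<noteq> 0}" and sub: "{u. v u \<noteq> 0} \<subseteq> SC" using v by (auto simp: free_vs_def)
  have SC: "u \<in> SC" if "v (act_uf act \<pi> u) \<noteq> 0" for u
    using sub that SC_act[OF _ fix_grp_inv[OF p], of "act_uf act \<pi> u"] a by auto
  show "(\<lambda>u. v (act_uf act \<pi> u)) \<in> free_vs SC"
    using bij_betw_finite[OF b] fin SC by (auto simp: free_vs_def)
  have "core_sum (\<lambda>u. v (act_uf act \<pi> u)) x =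
      (\<Sum>u | v (act_uf act \<pi> u) \<noteq> 0. if act \<pi> x \<in> core (act_uf act \<pi> u) then v (act_uf act \<pi> u) else 0)"
    unfolding core_sum_def by (rule sum.cong) (use core_act[OF SC p] in auto)
  also have "\<dots> = core_sum v (act \<pi> x)"
    unfolding core_sum_def by (rule sum.reindex_bij_betw[OF b])
  finally show "core_sum (\<lambda>u. v (act_uf act \<pi> u)) x = core_sum v (act \<pi> x)" .
qed

text \<open>A generic point of the core of a maximal member of the support separates it from the other cores.\<close>

lemma core_sum_eq_0_imp:
  assumes v: "v \<in> free_vs SC" and 0: "\<And>x. core_sum v x = 0"
  shows "v = (\<lambda>_. 0)"
proof (rule ccontr)
  assume "v \<noteq> (\<lambda>_. 0)"
  let ?T = "{u. v u \<noteq> 0}"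
  have T: "finite ?T" "?T \<subseteq> SC" using v by (auto simp: free_vs_def)
  obtain u0 where u0: "u0 \<in> ?T" using \<open>v \<noteq> (\<lambda>_. 0)\<close> by auto
  \<comment> \<open>Well-founded relations provide minimal elements, but a maximal one is wanted. On
    the finite support well-foundedness gives acyclicity, hence a well-founded converse. At a
    maximal \<open>u\<close> no other core of the support belongs to \<open>u\<close>.\<close>
  let ?r = "below \<inter> ?T \<times> ?T"
  have "wf ?r" using wf_below by (rule wf_subset) blast
  moreover have "finite ?r" using T(1) by simp
  ultimately have "wf (?r\<inverse>)" using finite_acyclic_wf_converse wf_acyclic by blast
  then obtain u where u: "u \<in> ?T" "\<And>w. (w, u) \<in> ?r\<inverse> \<Longrightarrow> w \<notin> ?T" using u0 by (rule wfE_min) (rule that)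
  have uSC: "u \<in> SC" using u(1) T(2) by blast
  have other: "core w \<notin> u" if "w \<in> ?T - {u}" for w
    using that u(2)[of w] u(1) T(2) by (auto simp: below_def)
  have cP: "core w \<in> P" if "w \<in> ?T - {u}" for w using core_in_P T(2) that by blast
  have "(\<Union>w\<in>?T - {u}. core w) \<notin> u"
    using ultrafilter_UN[OF SC_ultrafilter[OF uSC] finite_Diff[OF T(1)] cP] other by meson
  moreover have "(\<Union>w\<in>?T - {u}. core w) \<in> P" by (rule fs_pow_UN[OF finite_Diff[OF T(1)] cP])
  ultimately have "core u - (\<Union>w\<in>?T - {u}. core w) \<in> u"
    using ultrafilter_Diff[OF SC_ultrafilter[OF uSC] core_mem[OF uSC]] by blast
  then have "core u - (\<Union>w\<in>?T - {u}. core w) \<noteq> {}" using ultrafilter_onD(3)[OF SC_ultrafilter[OF uSC]] by metis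
  then obtain x where x: "x \<in> core u" "\<And>w. w \<in> ?T - {u} \<Longrightarrow> x \<notin> core w" by blast
  have "core_sum v x = (\<Sum>w\<in>?T. if w = u then v u else 0)"
    unfolding core_sum_def by (rule sum.cong) (use x in auto)
  also have "\<dots> = v u" using T(1) u(1) by simp
  finally show False using 0 u(1) by simp
qed

lemma inj_on_core_sum: "inj_on core_sum (free_vs SC :: ('x set set \<Rightarrow> 'k::field) set)"
proof (rule inj_onI)
  fix v w :: "'x set set \<Rightarrow> 'k" assume vw: "v \<in> free_vs SC" "w \<in> free_vs SC" "core_sum v = core_sum w"
  let ?d = "\<lambda>u. v u + (-1) * w u"
  have w': "(\<lambda>u. (-1) * w u) \<in> free_vs SC" by (rule free_vs_scale[OF vw(2)])
  have "core_sum ?d x = 0" for x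
    using core_sum_add[OF vw(1) w', of x] core_sum_scale[OF vw(2), of "-1" x] vw(3) by simp
  then have "?d = (\<lambda>_. 0)" using core_sum_eq_0_imp[OF free_vs_add[OF vw(1) w']] by blast
  then have "?d u = 0" for u by (rule fun_cong)
  then show "v = w" by (auto simp: fun_eq_iff)
qed

lemma core_sum_in_fs_funs:
  assumes v: "v \<in> free_vs SC"
  shows "core_sum v \<in> fs_funs S act X"
proof -
  let ?T = "{u. v u \<noteq> 0}"
  have T: "finite ?T" "?T \<subseteq> SC" using v by (auto simp: free_vs_def)
  have "\<forall>u\<in>?T. \<exists>B. finite B \<and> supports_set S act B (core u)"
    using core_in_P T(2) unfolding fs_pow_def by blast
  then obtain B where B: "\<forall>u\<in>?T. finite (B u) \<and> supports_set S act (B u) (core u)"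
    unfolding bchoice_iff by (elim exE)
  let ?B = "A0 \<union> (\<Union>u\<in>?T. B u)"
  have "core_sum v x = 0" if "x \<notin> X" for x
  proof -
    have "x \<notin> core u" for u using that by (simp add: core_def)
    then show ?thesis by (simp add: core_sum_def)
  qed
  moreover have "act_set act \<pi> X = X \<and> (\<forall>x\<in>X. core_sum v (act \<pi> x) = core_sum v x)" if p: "\<pi> \<in> fix_grp S ?B" for \<pi>
  proof (intro conjI ballI)
    have "\<pi> \<in> fix_grp S A0" using p fix_grp_mono[of A0 ?B S] by blast
    then show "act_set act \<pi> X = X" using supports_setD[OF supp_X] by (simp add: act_set_def)
    have m: "act \<pi> x \<in> core u \<longleftrightarrow> x \<in> core u" if u: "u \<in> ?T" for u x
    proof -
      have "\<pi> \<in> fix_grp S (B u)" using p u fix_grp_mono[of "B u" ?B S] by blast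
      then show ?thesis using supports_set_mem B u by blast
    qed
    fix x
    show "core_sum v (act \<pi> x) = core_sum v x"
      unfolding core_sum_def by (rule sum.cong) (use m in auto)
  qed
  moreover have "finite ?B" using fin_A0 T(1) B by blast
  ultimately show ?thesis unfolding fs_funs_def by (intro CollectI conjI exI[of _ ?B]) blast+
qed

section \<open>Supported functions lie in the span\<close>

lemma indicator_in_span:
  assumes D: "D \<in> P"
  shows "(\<lambda>x. if x \<in> D then 1 else 0 :: 'k::field) \<in> core_sum ` free_vs SC"
proof -
  define Sp where "Sp = core_sum ` (free_vs SC :: ('x set set \<Rightarrow> 'k) set)"
  define ind where "ind D x = (if x \<in> D then 1 else 0 :: 'k)" for D :: "'x set" and x
  have Sp_add: "(\<lambda>x. f x + g x) \<in> Sp" if fg: "f \<in> Sp" "g \<in> Sp" for f g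
  proof -
    obtain v w where "v \<in> free_vs SC" "w \<in> free_vs SC" "f = core_sum v" "g = core_sum w"
      using fg unfolding Sp_def by blast
    then show ?thesis unfolding Sp_def
      by (intro image_eqI[OF _ free_vs_add[of v SC w]]) (auto simp: core_sum_add)
  qed
  have Sp_scale: "(\<lambda>x. c * f x) \<in> Sp" if f: "f \<in> Sp" for c f
  proof -
    obtain v where "v \<in> free_vs SC" "f = core_sum v" using f unfolding Sp_def by blast
    then show ?thesis unfolding Sp_def
      by (intro image_eqI[OF _ free_vs_scale[of v SC c]]) (auto simp: core_sum_scale)
  qed
  have Sp_core: "ind (core \<U>) \<in> Sp" if "\<U> \<in> SC" for \<U>
  proof -
    let ?v = "\<lambda>u. if u = \<U> then 1 else 0 :: 'k"
    have "?v \<in> free_vs SC" using that by (simp add: free_vs_def)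
    moreover have "core_sum ?v x = ind (core \<U>) x" for x by (simp add: core_sum_def ind_def)
    ultimately show ?thesis unfolding Sp_def by (intro image_eqI[of _ _ ?v]) auto
  qed
  have Sp_empty: "ind {} \<in> Sp"
  proof -
    have "(\<lambda>_. 0) \<in> free_vs SC" by (simp add: free_vs_def)
    moreover have "core_sum (\<lambda>_. 0) x = ind {} x" for x by (simp add: core_sum_def ind_def)
    ultimately show ?thesis unfolding Sp_def by (intro image_eqI[of _ _ "\<lambda>_. 0"]) auto
  qed
  have Sp_act: "ind (act \<pi> ` E) \<in> Sp" if E: "ind E \<in> Sp" and p: "\<pi> \<in> fix_grp S A0" for \<pi> E
  proof -
    obtain v where v: "v \<in> free_vs SC" "ind E = core_sum v" using E unfolding Sp_def by blast
    have "ind (act \<pi> ` E) x = core_sum v (act (inv \<pi>) x)" for x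
      using mem_image_act[OF fix_grp_aut[OF p]] by (simp add: ind_def flip: v(2))
    then have "ind (act \<pi> ` E) = core_sum (\<lambda>u. v (act_uf act (inv \<pi>) u))"
      using core_sum_act(2)[OF v(1) fix_grp_inv[OF p]] by auto
    then show ?thesis using core_sum_act(1)[OF v(1) fix_grp_inv[OF p]] unfolding Sp_def by blast
  qed
  \<comment> \<open>The condition is imposed on all supported subsets because the sets whose own
    indicator lies in the span need not be closed downwards; the hereditary version is an
    ideal.\<close>
  define I where "I = {E \<in> P. \<forall>D\<in>P. D \<subseteq> E \<longrightarrow> ind D \<in> Sp}"
  have I: "ideal_on P I"
    unfolding ideal_on_def
  proof (intro conjI ballI impI)
    show "{} \<in> I" using Sp_empty by (auto simp: I_def)
    show "U \<union> V \<in> I" if UV: "U \<in> I" "V \<in> I" for U V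
    proof -
      have P: "U \<in> P" "V \<in> P" using UV by (auto simp: I_def)
      have "ind D \<in> Sp" if D: "D \<in> P" "D \<subseteq> U \<union> V" for D
      proof -
        have "ind (D \<inter> U) \<in> Sp" using UV(1) D P fs_pow_Int by (simp add: I_def)
        moreover have "D - U \<subseteq> V" using D(2) by blast
        then have "ind (D - U) \<in> Sp" using UV(2) D P fs_pow_Diff by (simp add: I_def)
        moreover have "ind D = (\<lambda>x. ind (D \<inter> U) x + ind (D - U) x)" by (auto simp: ind_def)
        ultimately show ?thesis using Sp_add by simp
      qed
      then show ?thesis using P fs_pow_Un by (simp add: I_def)
    qed
    show "V \<in> I" if "U \<in> I" "V \<in> P" "V \<subseteq> U" for U V using that by (auto simp: I_def)
  qed (auto simp: I_def)
  have I_act: "act \<pi> ` E \<in> I" if p: "\<pi> \<in> fix_grp S A0" and E: "E \<in> I" for \<pi> E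
  proof -
    have a: "aut S \<pi>" using p fix_grp_aut by blast
    have "ind D \<in> Sp" if D: "D \<in> P" "D \<subseteq> act \<pi> ` E" for D
    proof -
      have "act (inv \<pi>) ` D \<subseteq> E" using image_mono[OF D(2), of "act (inv \<pi>)"] a by simp
      then have "ind (act (inv \<pi>) ` D) \<in> Sp" using E D(1) fs_pow_image[OF _ fix_grp_inv[OF p]] by (simp add: I_def)
      then have "ind (act \<pi> ` act (inv \<pi>) ` D) \<in> Sp" using p by (rule Sp_act)
      then show ?thesis using a by simp
    qed
    then show ?thesis using E fs_pow_image[OF _ p] by (simp add: I_def)
  qed
  note avoid = ex_ultrafilter_avoiding_ideal[OF I fin_A0 I_act]
  have core_I: "\<U> \<in> SC \<longrightarrow> core \<U> \<in> I" for \<U>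
  proof (induction \<U> rule: wf_induct_rule[OF wf_below])
    case (1 \<U>)
    show ?case
    proof
      assume U: "\<U> \<in> SC"
      note UF = ultrafilter_onD[OF SC_ultrafilter[OF U]]
      \<comment> \<open>An ultrafilter containing \<open>D\<close> and avoiding \<open>I\<close>
        would contain the core of \<open>\<U>\<close> and differ from \<open>\<U>\<close>, hence lie
        below it; by induction its own core would be in \<open>I\<close>.\<close>
      have small: "D \<in> I" if D: "D \<in> P" "D \<subseteq> core \<U>" "D \<notin> \<U>" for D
      proof (rule ccontr)
        assume "D \<notin> I"
        then obtain \<V> where V: "\<V> \<in> SC" "D \<in> \<V>" "\<V> \<inter> I = {}" using avoid D(1) by blast
        have "core \<U> \<in> \<V>" using ultrafilter_onD(5)[OF SC_ultrafilter[OF V(1)] V(2) core_in_P[OF U] D(2)] .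
        then have "(\<V>, \<U>) \<in> below" using U V(1,2) D(3) by (auto simp: below_def)
        then have "core \<V> \<in> I" using 1 V(1) by blast
        then show False using core_mem[OF V(1)] V(3) by blast
      qed
      have "ind D \<in> Sp" if D: "D \<in> P" "D \<subseteq> core \<U>" for D
      proof (cases "D \<in> \<U>")
        case False
        then show ?thesis using small[OF D] D(1) by (simp add: I_def)
      next
        case True
        \<comment> \<open>A subset of the core that does belong to \<open>\<U>\<close> is reached
          from above: the core minus a remainder outside \<open>\<U>\<close>, which was just
          handled.\<close>
        have "core \<U> - D \<notin> \<U>"
        proof
          assume "core \<U> - D \<in> \<U>"
          then have "D \<inter> (core \<U> - D) \<in> \<U>" using UF(4)[OF True] by blast
          then show False using UF(3) by simp
        qed
        then have "core \<U> - D \<in> I" using small fs_pow_Diff[OF core_in_P[OF U] D(1)] by blast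
        then have "ind (core \<U> - D) \<in> Sp" by (simp add: I_def)
        then have "(\<lambda>x. ind (core \<U>) x + (-1) * ind (core \<U> - D) x) \<in> Sp"
          by (rule Sp_add[OF Sp_core[OF U] Sp_scale])
        moreover have "(\<lambda>x. ind (core \<U>) x + (-1) * ind (core \<U> - D) x) = ind D"
          using D(2) by (auto simp: ind_def fun_eq_iff)
        ultimately show ?thesis by simp
      qed
      then show "core \<U> \<in> I" using core_in_P[OF U] by (simp add: I_def)
    qed
  qed
  have "X \<in> I"
  proof (rule ccontr)
    assume "X \<notin> I"
    then obtain \<V> where V: "\<V> \<in> SC" "\<V> \<inter> I = {}" using avoid[OF _ _ fs_pow_X] by blast
    then show False using core_I core_mem by blast
  qed
  then have "ind D \<in> Sp" using D fs_pow_subset by (simp add: I_def)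
  moreover have "ind D = (\<lambda>x. if x \<in> D then 1 else 0)" by (simp add: ind_def fun_eq_iff)
  ultimately show ?thesis unfolding Sp_def by simp
qed

text \<open>A supported function is constant on each of the finitely many orbits over its support,
  hence a finite combination of indicators of supported level sets.\<close>

lemma fs_funs_in_span:
  fixes f :: "'x \<Rightarrow> 'k::field"
  assumes f: "f \<in> fs_funs S act X"
  shows "f \<in> core_sum ` free_vs SC"
proof -
  obtain B where B: "finite B" "\<And>\<pi>. \<pi> \<in> fix_grp S B \<Longrightarrow> act_set act \<pi> X = X"
      "\<And>\<pi> x. \<pi> \<in> fix_grp S B \<Longrightarrow> x \<in> X \<Longrightarrow> f (act \<pi> x) = f x"
    and f0: "\<And>x. x \<notin> X \<Longrightarrow> f x = 0" using f unfolding fs_funs_def by blast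
  have BX: "act \<pi> x \<in> X" if "\<pi> \<in> fix_grp S B" "x \<in> X" for \<pi> x
    using B(2)[OF that(1)] that(2) unfolding act_set_def by blast
  define h where "h T = f (SOME y. y \<in> T)" for T
  have "f x = h (orbit S act B x)" if x: "x \<in> X" for x
  proof -
    have "x \<in> orbit S act B x" by (rule orbit_self)
    then have "(SOME y. y \<in> orbit S act B x) \<in> orbit S act B x" by (rule someI)
    then show ?thesis using B(3) x by (auto simp: orbit_def h_def)
  qed
  then have "f ` X \<subseteq> h ` (orbit S act B ` X)" by auto
  then have fin: "finite (f ` X)" using finite_orbits[OF B(1)] finite_surj by blast
  have lev: "{x \<in> X. f x = c} \<in> P" for c
    by (rule fs_powI[OF _ B(1)]) (use B(3) BX in \<open>auto intro!: supports_setI\<close>)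
  \<comment> \<open>An arbitrary finite set of values replaces the range of \<open>f\<close>, so
    that induction applies; the guard keeps points outside \<open>X\<close> at zero.\<close>
  have "(\<lambda>x. \<Sum>c\<in>C. if x \<in> X \<and> f x = c then c else 0) \<in> core_sum ` free_vs SC" if "finite C" for C
    using that
  proof (induction C rule: finite_induct)
    case empty
    have "(\<lambda>_. 0) \<in> free_vs SC" by (simp add: free_vs_def)
    moreover have "core_sum (\<lambda>_. 0) x = 0" for x by (simp add: core_sum_def)
    ultimately show ?case by (intro image_eqI[of _ _ "\<lambda>_. 0"]) (auto simp: fun_eq_iff)
  next
    case (insert c C)
    obtain v :: "'x set set \<Rightarrow> 'k" where v: "v \<in> free_vs SC"
        "(\<lambda>x. \<Sum>c\<in>C. if x \<in> X \<and> f x = c then c else 0) = core_sum v"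
      using insert.IH by (elim imageE)
    obtain w :: "'x set set \<Rightarrow> 'k" where w: "w \<in> free_vs SC" "(\<lambda>x. if x \<in> {x \<in> X. f x = c} then 1 else 0) = core_sum w"
      using indicator_in_span[OF lev[of c]] by (elim imageE)
    have v': "core_sum v x = (\<Sum>c\<in>C. if x \<in> X \<and> f x = c then c else 0)" for x
      using fun_cong[OF v(2), of x] by simp
    have w': "core_sum w x = (if x \<in> X \<and> f x = c then 1 else 0)" for x
      using fun_cong[OF w(2), of x] by simp
    show ?case
    proof (rule image_eqI[of _ _ "\<lambda>u. c * w u + v u"])
      show "(\<lambda>u. c * w u + v u) \<in> free_vs SC" using v(1) w(1) free_vs_add free_vs_scale by blast
      show "(\<lambda>x. \<Sum>c\<in>insert c C. if x \<in> X \<and> f x = c then c else 0) = core_sum (\<lambda>u. c * w u + v u)"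
        using insert.hyps by (auto simp: core_sum_add[OF free_vs_scale[OF w(1)] v(1)] core_sum_scale[OF w(1)] v' w')
    qed
  qed
  from this[OF fin] have "(\<lambda>x. \<Sum>c\<in>f ` X. if x \<in> X \<and> f x = c then c else 0) \<in> core_sum ` free_vs SC" .
  moreover have "(\<Sum>c\<in>f ` X. if x \<in> X \<and> f x = c then c else 0) = f x" for x
    using fin f0 by (cases "x \<in> X") auto
  ultimately show ?thesis by simp
qed

text \<open>The map is supported by \<open>A0\<close> itself, as cores are equivariant under all
  automorphisms fixing \<open>A0\<close>.\<close>

theorem core_sum_fs_linear_iso: "fs_linear_iso S act X (core_sum :: _ \<Rightarrow> 'x \<Rightarrow> 'k::field)"
proof -
  have "core_sum ` free_vs SC = (fs_funs S act X :: ('x \<Rightarrow> 'k) set)"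
    using core_sum_in_fs_funs fs_funs_in_span by blast
  then show ?thesis
    unfolding fs_linear_iso_def Let_def bij_betw_def
    using inj_on_core_sum core_sum_add core_sum_scale core_sum_act(2) fin_A0
    by (intro conjI ballI allI exI[of _ A0] ext) auto
qed

end

theorem mainTheorem1:
  fixes S :: "('a, 'f, 'r) fo_structure"
    and act :: "('a \<Rightarrow> 'a) \<Rightarrow> 'x \<Rightarrow> 'x"
    and X :: "'x set"
  assumes "countable (UNIV :: 'a set)"
    and "omega_categorical S"
    and "omega_stable S"
    and "zfa_universe S act"
    and "definable_set S act X"
  shows "\<exists>\<Phi> :: ('x set set \<Rightarrow> 'k::field) \<Rightarrow> ('x \<Rightarrow> 'k). fs_linear_iso S act X \<Phi>"
proof -
  obtain A0 where "finite A0" "supports_set S act A0 X" "finite (orbit S act A0 ` X)"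
    using assms(5) unfolding definable_set_def by blast
  then interpret definable_nominal S act A0 X
    using assms(1-4) by unfold_locales
  show ?thesis using core_sum_fs_linear_iso by blast
qed

end
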